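(* Let $S$ be a finite or countably infinite set of dominant rational self-maps of $\mathbb{P}^N$ (over $\overline{\mathbb{Q}}$), let $\nu$ be a probability measure on $S$ (all subsets of $S$ measurable), and let $(\Phi_S,\bar{\nu})$ be the space of i.i.d. sequences of elements of $S$ distributed according to $\nu$. Suppose that $\mathbb{E}_1[\log\deg(\phi)]=\sum_{\phi\in S}\nu(\phi)\log\deg(\phi)$ exists (is finite). Define \[\delta_{S,\nu}:=\exp\Bigg(\inf_{n\geq1}\frac{\mathbb{E}_n\big[\log\deg(\gamma_n)\big]}{n}\Bigg).\] Then for $\bar{\nu}$-almost every sequence $\gamma\in\Phi_S$, the limit $\delta_\gamma:=\lim_{n\to\infty}\deg(\gamma_n)^{1/n}$ exists and equals $\delta_{S,\nu}$.
   Context: $\Phi_S=\prod_{i=1}^\infty S$ with the product measure $\bar\nu$ induced by $\nu$. For $\gamma=(\theta_1,\theta_2,\dots)\in\Phi_S$, set $\gamma_n=\theta_n\circ\theta_{n-1}\circ\cdots\circ\theta_1$. $\Phi_{S,n}=S^n$ carries the product measure $\nu_n$, and for a function $f_n$ on $n$-term sequences, $\mathbb{E}_n[f_n]=\int_{\Phi_{S,n}}f_n\,d\nu_n$; in particular $\mathbb{E}_n[\log\deg(\gamma_n)]$ is the expected value of $\log\deg(\theta_n\circ\cdots\circ\theta_1)$ over $(\theta_1,\dots,\theta_n)\in S^n$. $\deg$ denotes the degree of a rational map of $\mathbb{P}^N$. *)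

theory Defs
  imports "HOL-Probability.Probability" "HOL-Library.Poly_Mapping"
begin

text \<open>Polynomials in the variables X_0, X_1, ... with complex coefficients:
  a monomial is a finitely supported exponent vector nat =>0 nat.\<close>
type_synonym mpoly = "(nat \<Rightarrow>\<^sub>0 nat) \<Rightarrow>\<^sub>0 complex"

text \<open>A (representative of a) rational self-map of P^N: an (N+1)-tuple of
  homogeneous polynomials in X_0..X_N (entries beyond N are ignored).\<close>
type_synonym rmap = "nat \<Rightarrow> mpoly"

definition var :: "nat \<Rightarrow> mpoly" where
  "var i = Poly_Mapping.single (Poly_Mapping.single i 1) 1"

definition subst :: "mpoly \<Rightarrow> rmap \<Rightarrow> mpoly" where
  "subst H F = (\<Sum>m\<in>Poly_Mapping.keys H. Poly_Mapping.single 0 (Poly_Mapping.lookup H m) *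
                  (\<Prod>i\<in>Poly_Mapping.keys m. F i ^ Poly_Mapping.lookup m i))"

definition in_vars :: "nat \<Rightarrow> mpoly \<Rightarrow> bool" where
  "in_vars N H \<longleftrightarrow> (\<forall>m\<in>Poly_Mapping.keys H. Poly_Mapping.keys m \<subseteq> {..N})"

definition homog :: "nat \<Rightarrow> nat \<Rightarrow> mpoly \<Rightarrow> bool" where
  "homog N d H \<longleftrightarrow> in_vars N H \<and> (\<forall>m\<in>Poly_Mapping.keys H. (\<Sum>i\<in>Poly_Mapping.keys m. Poly_Mapping.lookup m i) = d)"

definition rep :: "nat \<Rightarrow> rmap \<Rightarrow> nat \<Rightarrow> bool" where
  "rep N F d \<longleftrightarrow> (\<forall>i\<le>N. homog N d (F i)) \<and> (\<exists>i\<le>N. F i \<noteq> 0)"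

definition same_map :: "nat \<Rightarrow> rmap \<Rightarrow> rmap \<Rightarrow> bool" where
  "same_map N F G \<longleftrightarrow> (\<forall>i\<le>N. \<forall>j\<le>N. F i * G j = F j * G i)"

text \<open>Degree of the rational map: the least degree of a defining tuple
  (i.e. the common degree after cancelling the gcd of the components).\<close>
definition rdeg :: "nat \<Rightarrow> rmap \<Rightarrow> nat" where
  "rdeg N F = (LEAST d. \<exists>G. rep N G d \<and> same_map N F G)"

text \<open>Dominant: the components are algebraically independent, i.e. no nonzero
  polynomial in X_0..X_N vanishes on (F_0,...,F_N).\<close>
definition dominant :: "nat \<Rightarrow> rmap \<Rightarrow> bool" where
  "dominant N F \<longleftrightarrow> (\<forall>H. in_vars N H \<longrightarrow> subst H F = 0 \<longrightarrow> H = 0)"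

definition dom_rat_map :: "nat \<Rightarrow> rmap \<Rightarrow> bool" where
  "dom_rat_map N F \<longleftrightarrow> (\<exists>d. rep N F d) \<and> (\<forall>i\<le>N. \<forall>m. algebraic (Poly_Mapping.lookup (F i) m))
                       \<and> dominant N F"

definition rcomp :: "rmap \<Rightarrow> rmap \<Rightarrow> rmap" where
  "rcomp \<psi> \<phi> = (\<lambda>i. subst (\<psi> i) \<phi>)"

text \<open>gamma_n = theta_n o ... o theta_1, where theta_(k+1) = th k.\<close>
primrec gamma :: "(nat \<Rightarrow> rmap) \<Rightarrow> nat \<Rightarrow> rmap" where
  "gamma th 0 = var"
| "gamma th (Suc n) = rcomp (th n) (gamma th n)"

definition En_logdeg :: "nat \<Rightarrow> rmap pmf \<Rightarrow> nat \<Rightarrow> real" where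
  "En_logdeg N \<nu> n = (\<integral>th. ln (real (rdeg N (gamma th n))) \<partial>(PiM {..<n} (\<lambda>_. measure_pmf \<nu>)))"

definition delta :: "nat \<Rightarrow> rmap pmf \<Rightarrow> real" where
  "delta N \<nu> = exp (INF n\<in>{1..}. En_logdeg N \<nu> n / real n)"

end

theory Submission
  imports Defs
begin

text \<open>Put \<open>f\<^sub>n(\<gamma>) = log deg \<gamma>\<^sub>n\<close> and let \<open>T\<close> be the shift on \<open>\<Phi>\<^sub>S\<close>. Submultiplicativity of the degree under
  composition of dominant maps makes \<open>f\<close> a subadditive process over \<open>T\<close>, \<open>T\<close> is ergodic by
  Kolmogorov's 0-1 law, and the theorem is Kingman's subadditive ergodic theorem. Its lower bound is the
  Katznelson--Weiss argument: if \<open>f\<^sub>n < q n\<close> happens infinitely often with positive probability, then by ergodicity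
  almost every orbit can be cut greedily into blocks on which the process is at most \<open>q\<close> times the
  length, up to a small set of bad times, so the mean rate is at most \<open>q\<close>. Applied to the Birkhoff sums of
  \<open>f\<close> and \<open>-f\<close> the same bound yields Birkhoff's theorem, from which the upper bound follows.

  \<^const>\<open>En_logdeg\<close> is a Bochner integral, hence 0 for non-measurable integrands, and the product
  sigma-algebra over the uncountable type of all tuples does not contain every set. So one needs that
  the degree of \<open>\<gamma>\<^sub>n\<close> is measurable on the whole product space: \<open>deg F \<le> d\<close> says that a
  linear system in finitely many unknowns, whose coefficients are coefficients of \<open>F\<close>, has a
  nontrivial solution, and this is a measurable condition by Gaussian elimination.\<close>

section \<open>Kingman's subadditive ergodic theorem\<close>

text \<open>Read \<open>{i..<i+n}\<close> as a stretch of an orbit and cut it from the left: from a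
  good time jump over a block of length at most \<open>L\<close> that costs at most 0, from a bad
  time take one step at cost \<open>b\<close>. A last piece of length at most \<open>L\<close> is
  paid for in full by the second sum.\<close>

lemma greedy_block_bound:
  fixes a :: "nat \<Rightarrow> nat \<Rightarrow> real" and b :: "nat \<Rightarrow> real"
  assumes sub: "\<And>i m n. a i (m + n) \<le> a i m + a (i + m) n"
    and zero: "\<And>i. a i 0 = 0"
    and one: "\<And>i. a i 1 \<le> b i"
    and nonneg: "\<And>i. 0 \<le> b i"
    and good: "\<And>i. i \<notin> B \<Longrightarrow> \<exists>k\<in>{1..L}. a i k \<le> 0"
  shows "a i n \<le> (\<Sum>j\<in>{i..<i+n} \<inter> B. b j) + (\<Sum>j\<in>{i+n-L..<i+n}. b j)"
proof (induction n arbitrary: i rule: less_induct)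
  case (less n)
  have short: "a i n \<le> (\<Sum>j\<in>{i..<i+n}. b j)" for i n
  proof (induction n)
    case 0
    then show ?case by (simp add: zero)
  next
    case (Suc n)
    have "a i (n + 1) \<le> a i n + a (i + n) 1" by (rule sub)
    with Suc one[of "i + n"] show ?case by (simp add: algebra_simps)
  qed
  \<comment> \<open>The final window depends only on the endpoint \<open>i + n\<close>, so the
    induction hypothesis for what remains after the first block produces the same window.\<close>
  have cut: "a i n \<le> (\<Sum>j\<in>{i..<i+n} \<inter> B. b j) + (\<Sum>j\<in>{i+n-L..<i+n}. b j)"
    if k: "1 \<le> k" "k \<le> n" and head: "a i k \<le> (\<Sum>j\<in>{i..<i+k} \<inter> B. b j)" for k
  proof -
    have "a i (k + (n - k)) \<le> a i k + a (i + k) (n - k)" by (rule sub)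
    then have "a i n \<le> a i k + a (i + k) (n - k)" using k by simp
    also have "\<dots> \<le> (\<Sum>j\<in>{i..<i+k} \<inter> B. b j)
        + ((\<Sum>j\<in>{i+k..<i+k+(n-k)} \<inter> B. b j) + (\<Sum>j\<in>{i+k+(n-k)-L..<i+k+(n-k)}. b j))"
      using head less.IH[of "n - k" "i + k"] k by (intro add_mono) auto
    also have "\<dots> = (\<Sum>j\<in>({i..<i+k} \<inter> B) \<union> ({i+k..<i+n} \<inter> B). b j) + (\<Sum>j\<in>{i+n-L..<i+n}. b j)"
      using k by (subst sum.union_disjoint) auto
    also have "({i..<i+k} \<inter> B) \<union> ({i+k..<i+n} \<inter> B) = {i..<i+n} \<inter> B"
      using k by auto
    finally show ?thesis .
  qed
  show ?case
  proof (cases "n \<le> L")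
    case True
    have "a i n \<le> (\<Sum>j\<in>{i..<i+n}. b j)" by (rule short)
    \<comment> \<open>For \<open>n \<le> L\<close> the window starts at or before \<open>i\<close>
      and covers the whole stretch.\<close>
    also have "\<dots> \<le> (\<Sum>j\<in>{i+n-L..<i+n}. b j)"
      using True by (intro sum_mono2) (auto simp: nonneg)
    finally show ?thesis
      using sum_nonneg[of "{i..<i+n} \<inter> B" b] nonneg by auto
  next
    case False
    show ?thesis
    proof (cases "i \<in> B")
      case True
      show ?thesis
      proof (rule cut)
        show "a i 1 \<le> (\<Sum>j\<in>{i..<i+1} \<inter> B. b j)"
          using one[of i] True by simp
      qed (use False in auto)
    next
      case False
      then obtain k where "k \<in> {1..L}" "a i k \<le> 0" using good by blast
      then show ?thesis
        using \<open>\<not> n \<le> L\<close> sum_nonneg[of "{i..<i+k} \<inter> B" b] nonneg by (intro cut[of k]) auto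
    qed
  qed
qed

section \<open>Ergodic measure-preserving maps\<close>

locale ergodic_map = prob_space M for M :: "'a measure" +
  fixes T :: "'a \<Rightarrow> 'a"
  assumes measurable_T [measurable]: "T \<in> measurable M M"
    and distr_T: "distr M M T = M"
    and ergodic: "\<And>A. A \<in> sets M \<Longrightarrow> T -` A \<inter> space M = A \<Longrightarrow> prob A = 0 \<or> prob A = 1"
begin

lemma measurable_iter [measurable]: "(T ^^ n) \<in> measurable M M"
  by (induction n) (auto intro: measurable_comp[OF _ measurable_T])

lemma iter_space: "x \<in> space M \<Longrightarrow> (T ^^ n) x \<in> space M"
  using measurable_space[OF measurable_iter] by blast

lemma distr_iter: "distr M M (T ^^ n) = M"
proof (induction n)
  case 0
  then show ?case by (simp add: id_def distr_id)
next
  case (Suc n)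
  have "distr M M (T ^^ Suc n) = distr (distr M M (T ^^ n)) M T"
    by (subst distr_distr) (simp_all add: comp_def)
  then show ?case by (simp only: Suc distr_T)
qed

lemma integral_iter:
  fixes f :: "'a \<Rightarrow> real"
  assumes "f \<in> borel_measurable M"
  shows "(\<integral>x. f ((T ^^ n) x) \<partial>M) = (\<integral>x. f x \<partial>M)"
  using integral_distr[OF measurable_iter assms, of n] by (simp add: distr_iter)

lemma integrable_iter:
  fixes f :: "'a \<Rightarrow> real"
  assumes "integrable M f"
  shows "integrable M (\<lambda>x. f ((T ^^ n) x))"
  using integrable_distr[OF measurable_iter, of n f] assms by (simp add: distr_iter)

text \<open>The iterated preimages of \<open>A\<close> decrease and all have the measure of
  \<open>A\<close>. Their intersection is strictly invariant, so ergodicity applies to it, and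
  continuity from above carries the value back to \<open>A\<close>.\<close>

lemma prob_backward_invariant:
  assumes A [measurable]: "A \<in> sets M" and sub: "T -` A \<inter> space M \<subseteq> A"
  shows "prob A = 0 \<or> prob A = 1"
proof -
  define C where "C n = (T ^^ n) -` A \<inter> space M" for n
  have C [measurable]: "C n \<in> sets M" for n
    unfolding C_def by measurable
  have step: "C (Suc n) \<subseteq> C n" for n
    using sub iter_space by (auto simp: C_def)
  have dec: "decseq C"
    by (rule decseq_SucI) (rule step)
  have prob_C: "prob (C n) = prob A" for n
    using measure_distr[OF measurable_iter, of A n] by (simp add: distr_iter C_def)
  have pre: "T -` C n \<inter> space M = C (Suc n)" for n
    using measurable_space[OF measurable_T] by (auto simp: C_def funpow_swap1)
  have "T -` (\<Inter>n. C n) \<inter> space M = (\<Inter>n. T -` C n \<inter> space M)"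
    by auto
  also have "\<dots> = (\<Inter>n. C (Suc n))"
    by (simp add: pre)
  also have "\<dots> = (\<Inter>n. C n)"
    using step by blast
  finally have "prob (\<Inter>n. C n) = 0 \<or> prob (\<Inter>n. C n) = 1"
    by (intro ergodic) auto
  moreover have "(\<lambda>n. prob (C n)) \<longlonglongrightarrow> prob (\<Inter>n. C n)"
    using dec by (intro finite_Lim_measure_decseq) auto
  then have "prob (\<Inter>n. C n) = prob A"
    by (simp add: prob_C LIMSEQ_const_iff)
  ultimately show ?thesis by simp
qed

end

section \<open>Subadditive processes and the lower bound\<close>

locale subadditive_process = ergodic_map +
  fixes g :: "nat \<Rightarrow> 'a \<Rightarrow> real"
  assumes integrable_g: "\<And>n. integrable M (g n)"
    and g_zero: "\<And>x. x \<in> space M \<Longrightarrow> g 0 x = 0"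
    and g_add: "\<And>m n x. x \<in> space M \<Longrightarrow> g (m + n) x \<le> g m x + g n ((T ^^ m) x)"
begin

lemma measurable_g [measurable]: "g n \<in> borel_measurable M"
  using integrable_g by auto

text \<open>The bad points are those of \<open>B L\<close>, from which no block of length at most
  \<open>L\<close> has a nonpositive value. The greedy bound along an orbit, integrated and divided
  by \<open>n\<close>, leaves the mean of \<open>b\<close> over \<open>B L\<close>; this vanishes as
  \<open>L\<close> grows, because almost every point has some nonpositive block.\<close>

lemma mean_nonpos:
  assumes gam: "\<And>n. n \<ge> 1 \<Longrightarrow> \<gamma> * real n \<le> (\<integral>x. g n x \<partial>M)"
    and ae: "AE x in M. \<exists>k\<ge>1. g k x \<le> 0"
  shows "\<gamma> \<le> 0"
proof -
  define b where "b x = \<bar>g 1 x\<bar>" for x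
  define B where "B L = {x \<in> space M. \<not> (\<exists>k\<in>{1..L}. g k x \<le> 0)}" for L :: nat
  have b: "integrable M b" "\<And>x. 0 \<le> b x"
    unfolding b_def using integrable_g by auto
  have bm [measurable]: "b \<in> borel_measurable M" using b by auto
  have B [measurable]: "B L \<in> sets M" for L
    unfolding B_def by measurable
  let ?c = "\<lambda>L x. b x * indicator (B L) x"
  have c: "integrable M (?c L)" for L
    using b(1) B integrable_mult_indicator[of "B L" M b] by (simp add: mult.commute)
  have bound: "\<gamma> \<le> (\<integral>x. ?c L x \<partial>M)" for L
  proof -
    \<comment> \<open>The last term comes from the final window, which has exactly \<open>L\<close>
      times once \<open>n \<ge> L\<close>; it disappears after division by \<open>n\<close>.\<close>
    have "\<gamma> * real n \<le> real n * (\<integral>x. ?c L x \<partial>M) + real L * (\<integral>x. b x \<partial>M)" if n: "n \<ge> 1" "n \<ge> L" for n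
    proof -
      have pw: "g n x \<le> (\<Sum>j<n. ?c L ((T ^^ j) x)) + (\<Sum>j\<in>{n-L..<n}. b ((T ^^ j) x))"
        if x: "x \<in> space M" for x
      proof -
        have "g n ((T ^^ 0) x) \<le> (\<Sum>j\<in>{0..<0+n} \<inter> {j. (T ^^ j) x \<in> B L}. b ((T ^^ j) x))
                + (\<Sum>j\<in>{0+n-L..<0+n}. b ((T ^^ j) x))"
        proof (rule greedy_block_bound[where a = "\<lambda>i n. g n ((T ^^ i) x)"])
          show "g (m + n) ((T ^^ i) x) \<le> g m ((T ^^ i) x) + g n ((T ^^ (i + m)) x)" for i m n
            using g_add[OF iter_space[OF x], of m n i] by (simp add: funpow_add add.commute[of i m])
          show "\<exists>k\<in>{1..L}. g k ((T ^^ i) x) \<le> 0" if "i \<notin> {j. (T ^^ j) x \<in> B L}" for i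
            using that iter_space[OF x, of i] by (auto simp: B_def)
        qed (use iter_space[OF x] g_zero in \<open>auto simp: b_def\<close>)
        also have "(\<Sum>j\<in>{0..<0+n} \<inter> {j. (T ^^ j) x \<in> B L}. b ((T ^^ j) x)) = (\<Sum>j<n. ?c L ((T ^^ j) x))"
          by (simp add: sum.inter_restrict indicator_def if_distrib lessThan_atLeast0 cong: if_cong)
        finally show ?thesis by simp
      qed
      have int1: "integrable M (\<lambda>x. \<Sum>j<n. ?c L ((T ^^ j) x))"
        using integrable_iter[OF c] by (intro Bochner_Integration.integrable_sum)
      have int2: "integrable M (\<lambda>x. \<Sum>j\<in>{n-L..<n}. b ((T ^^ j) x))"
        using integrable_iter[OF b(1)] by (intro Bochner_Integration.integrable_sum)
      have "\<gamma> * real n \<le> (\<integral>x. g n x \<partial>M)" using gam n by simp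
      also have "\<dots> \<le> (\<integral>x. (\<Sum>j<n. ?c L ((T ^^ j) x)) + (\<Sum>j\<in>{n-L..<n}. b ((T ^^ j) x)) \<partial>M)"
        using int1 int2 pw by (intro integral_mono integrable_g Bochner_Integration.integrable_add) auto
      also have "\<dots> = (\<Sum>j<n. \<integral>x. ?c L ((T ^^ j) x) \<partial>M) + (\<Sum>j\<in>{n-L..<n}. \<integral>x. b ((T ^^ j) x) \<partial>M)"
        unfolding Bochner_Integration.integral_add[OF int1 int2]
        using integrable_iter[OF c] integrable_iter[OF b(1)]
        by (intro arg_cong2[of _ _ _ _ "(+)"] Bochner_Integration.integral_sum)
      also have "\<dots> = real n * (\<integral>x. ?c L x \<partial>M) + real L * (\<integral>x. b x \<partial>M)"
        using n by (simp add: integral_iter[OF bm] integral_iter[OF borel_measurable_integrable[OF c]])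
      finally show ?thesis .
    qed
    then have ev: "\<forall>\<^sub>F n in sequentially. \<gamma> \<le> (\<integral>x. ?c L x \<partial>M) + (real L * (\<integral>x. b x \<partial>M)) / real n"
      by (intro eventually_sequentiallyI[of "max 1 L"]) (simp add: field_simps)
    have "(\<lambda>n. (\<integral>x. ?c L x \<partial>M) + (real L * (\<integral>x. b x \<partial>M)) / real n) \<longlonglongrightarrow> (\<integral>x. ?c L x \<partial>M) + 0"
      by (intro tendsto_add tendsto_const lim_const_over_n)
    then show ?thesis
      using ev by (intro tendsto_lowerbound[where F = sequentially]) auto
  qed
  have "(\<lambda>L. \<integral>x. ?c L x \<partial>M) \<longlonglongrightarrow> (\<integral>x. 0 \<partial>M)"
  proof (rule integral_dominated_convergence[where w = b])
    show "AE x in M. (\<lambda>L. ?c L x) \<longlonglongrightarrow> 0"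
      using ae
    proof eventually_elim
      case (elim x)
      then obtain k where k: "k \<ge> 1" "g k x \<le> 0" by blast
      have "\<forall>\<^sub>F L in sequentially. ?c L x = 0"
        using k by (intro eventually_sequentiallyI[of k]) (auto simp: B_def indicator_def)
      then show ?case by (rule tendsto_eventually)
    qed
  qed (use b in \<open>auto simp: indicator_def\<close>)
  then have "(\<lambda>L. \<integral>x. ?c L x \<partial>M) \<longlonglongrightarrow> 0" by simp
  then show ?thesis
    using bound by (intro tendsto_lowerbound[where F = sequentially]) auto
qed

lemma eventually_ge_neg:
  assumes gam: "\<And>n. n \<ge> 1 \<Longrightarrow> \<gamma> * real n \<le> (\<integral>x. g n x \<partial>M)" and pos: "\<gamma> > 0" and e: "\<epsilon> > 0"
  shows "AE x in M. \<forall>\<^sub>F n in sequentially. g n x \<ge> - \<epsilon> * real n"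
proof -
  \<comment> \<open>The set where the limit inferior of \<open>g n x / n\<close> is negative.
    Leaving \<open>j\<close> existential gives the room needed for the preimage of \<open>A\<close>
    to lie in \<open>A\<close>.\<close>
  define A where "A = {x \<in> space M. \<exists>j::nat. \<forall>K::nat. \<exists>n\<ge>K. g n x < - (1 / (real j + 1)) * real n}"
  have A [measurable]: "A \<in> sets M"
    unfolding A_def by measurable
  have "T -` A \<inter> space M \<subseteq> A"
  proof
    fix x assume x: "x \<in> T -` A \<inter> space M"
    then obtain j :: nat where j: "\<And>K::nat. \<exists>n\<ge>K. g n (T x) < - (1 / (real j + 1)) * real n"
      by (auto simp: A_def)
    \<comment> \<open>Going back from \<open>T x\<close> to \<open>x\<close> costs
      \<open>g 1 x\<close> and adds one unit of length. Relaxing \<open>j\<close> to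
      \<open>Suc j\<close> gains \<open>d\<close> per unit of time, which outweighs both from
      \<open>K0\<close> on.\<close>
    define d where "d = 1 / (real j + 1) - 1 / (real (Suc j) + 1)"
    have d: "d > 0" by (simp add: d_def divide_strict_left_mono)
    obtain K0 :: nat where K0: "real K0 * d > g 1 x + 1 / (real (Suc j) + 1)"
      using reals_Archimedean3[OF d] by blast
    have "\<exists>n\<ge>K. g n x < - (1 / (real (Suc j) + 1)) * real n" for K
    proof -
      obtain n where n: "n \<ge> max K K0" "g n (T x) < - (1 / (real j + 1)) * real n"
        using j by blast
      have "g (1 + n) x \<le> g 1 x + g n ((T ^^ 1) x)"
        using x by (intro g_add) auto
      also have "\<dots> < g 1 x - (1 / (real j + 1)) * real n"
        using n by simp
      also have "\<dots> = g 1 x - d * real n - (1 / (real (Suc j) + 1)) * real n"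
        by (simp add: d_def algebra_simps)
      also have "\<dots> \<le> g 1 x - d * real K0 - (1 / (real (Suc j) + 1)) * real n"
        using n d by simp
      also have "\<dots> \<le> - 1 / (real (Suc j) + 1) - (1 / (real (Suc j) + 1)) * real n"
        using K0 by (simp add: algebra_simps)
      also have "\<dots> = - (1 / (real (Suc j) + 1)) * real (1 + n)"
        by (simp add: divide_simps) (simp add: algebra_simps)?
      finally show ?thesis using n by (intro exI[of _ "1 + n"]) auto
    qed
    then show "x \<in> A" using x by (auto simp: A_def simp del: of_nat_Suc)
  qed
  then have "prob A = 0 \<or> prob A = 1"
    by (intro prob_backward_invariant) auto
  moreover have "prob A \<noteq> 1"
  proof
    assume "prob A = 1"
    then have "AE x in M. x \<in> A"
      by (simp add: prob_eq_1)
    then have "AE x in M. \<exists>k\<ge>1. g k x \<le> 0"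
    proof eventually_elim
      case (elim x)
      then obtain j :: nat where "\<And>K::nat. \<exists>n\<ge>K. g n x < - (1 / (real j + 1)) * real n"
        by (auto simp: A_def)
      then obtain n where "n \<ge> 1" "g n x < - (1 / (real j + 1)) * real n"
        by blast
      moreover have "- (1 / (real j + 1)) * real n \<le> 0" by simp
      ultimately show ?case by (intro exI[of _ n]) linarith
    qed
    with mean_nonpos[OF gam] pos show False by simp
  qed
  ultimately have "AE x in M. x \<notin> A"
    by (simp add: prob_eq_0)
  then show ?thesis
    using AE_space
  proof eventually_elim
    case (elim x)
    obtain j :: nat where j: "1 / (real j + 1) < \<epsilon>"
      using e by (metis nat_approx_posE of_nat_Suc add.commute)
    obtain K where K: "\<And>n. n \<ge> K \<Longrightarrow> g n x \<ge> - (1 / (real j + 1)) * real n"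
    proof -
      have "\<exists>K. \<forall>n\<ge>K. \<not> g n x < - (1 / (real j + 1)) * real n"
        using elim unfolding A_def by blast
      then show thesis
        using that by (auto simp only: not_less)
    qed
    have "- \<epsilon> * real n \<le> - (1 / (real j + 1)) * real n" for n
      using j by (intro mult_right_mono) auto
    with K show ?case
      by (intro eventually_sequentiallyI[of K]) (meson order_trans)
  qed
qed

lemma eventually_ge:
  assumes gam: "\<And>n. n \<ge> 1 \<Longrightarrow> \<gamma> * real n \<le> (\<integral>x. g n x \<partial>M)" and q: "q < \<gamma>"
  shows "AE x in M. \<forall>\<^sub>F n in sequentially. g n x \<ge> q * real n"
proof -
  define r where "r = (q + \<gamma>) / 2"
  \<comment> \<open>Subtracting \<open>r * n\<close>, with \<open>r\<close> halfway between
    \<open>q\<close> and \<open>\<gamma>\<close>, leaves a process of positive rate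
    \<open>\<gamma> - r\<close>; the previous lemma is then used with
    \<open>\<epsilon> = r - q\<close>.\<close>
  interpret h: subadditive_process M T "\<lambda>n x. g n x - r * real n"
    by standard (use integrable_g g_zero g_add in \<open>auto simp: algebra_simps\<close>)
  have "AE x in M. \<forall>\<^sub>F n in sequentially. g n x - r * real n \<ge> - (r - q) * real n"
  proof (rule h.eventually_ge_neg[where \<gamma> = "\<gamma> - r"])
    show "(\<gamma> - r) * real n \<le> (\<integral>x. g n x - r * real n \<partial>M)" if "n \<ge> 1" for n
      using gam[OF that] integrable_g by (simp add: prob_space algebra_simps)
  qed (use q in \<open>auto simp: r_def\<close>)
  then show ?thesis
    by (simp add: algebra_simps)
qed

end

section \<open>Birkhoff's ergodic theorem\<close>

context ergodic_map
begin

lemma subadditive_process_birkhoff_sum: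
  fixes f :: "'a \<Rightarrow> real"
  assumes "integrable M f"
  shows "subadditive_process M T (\<lambda>n x. \<Sum>i<n. f ((T ^^ i) x))"
proof
  show "integrable M (\<lambda>x. \<Sum>i<n. f ((T ^^ i) x))" for n
    using integrable_iter[OF assms] by (intro Bochner_Integration.integrable_sum)
  show "(\<Sum>i<m+n. f ((T ^^ i) x)) \<le> (\<Sum>i<m. f ((T ^^ i) x)) + (\<Sum>i<n. f ((T ^^ i) ((T ^^ m) x)))" for m n x
    by (induction n) (simp_all add: funpow_add flip: add.commute[of _ m])
qed simp

theorem birkhoff:
  fixes f :: "'a \<Rightarrow> real"
  assumes f: "integrable M f"
  shows "AE x in M. (\<lambda>n. (\<Sum>i<n. f ((T ^^ i) x)) / real n) \<longlonglongrightarrow> (\<integral>x. f x \<partial>M)"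
proof -
  \<comment> \<open>Countably many margins tending to 0, so that one null set serves them
    all.\<close>
  define e where "e j = 1 / (real j + 1)" for j
  have lower: "AE x in M. \<forall>j. \<forall>\<^sub>F n in sequentially. (\<Sum>i<n. h ((T ^^ i) x)) \<ge> ((\<integral>x. h x \<partial>M) - e j) * real n"
    if h: "integrable M h" for h :: "'a \<Rightarrow> real"
  proof -
    interpret s: subadditive_process M T "\<lambda>n x. \<Sum>i<n. h ((T ^^ i) x)"
      using h by (rule subadditive_process_birkhoff_sum)
    show ?thesis
      unfolding AE_all_countable
    proof (intro allI s.eventually_ge)
      show "(\<integral>x. h x \<partial>M) * real n \<le> (\<integral>x. (\<Sum>i<n. h ((T ^^ i) x)) \<partial>M)" for n
        using integrable_iter[OF h] h
        by (subst Bochner_Integration.integral_sum) (auto simp: integral_iter)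
    qed (simp add: e_def)
  qed
  have "AE x in M. \<forall>j. \<forall>\<^sub>F n in sequentially. (\<Sum>i<n. - f ((T ^^ i) x)) \<ge> (- (\<integral>x. f x \<partial>M) - e j) * real n"
    using lower[of "\<lambda>x. - f x"] f by simp
  with lower[OF f] show ?thesis
  proof eventually_elim
    case (elim x)
    show ?case
    proof (rule LIMSEQ_I)
      fix r :: real assume "r > 0"
      then obtain j where j: "e j < r"
        unfolding e_def by (metis nat_approx_posE of_nat_Suc add.commute)
      have "\<forall>\<^sub>F n in sequentially. norm ((\<Sum>i<n. f ((T ^^ i) x)) / real n - (\<integral>x. f x \<partial>M)) < r"
        using elim(1)[rule_format, of j] elim(2)[rule_format, of j] eventually_ge_at_top[of 1]
      proof eventually_elim
        case (elim n)
        then have "(\<integral>x. f x \<partial>M) - e j \<le> (\<Sum>i<n. f ((T ^^ i) x)) / real n"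
            "(\<Sum>i<n. f ((T ^^ i) x)) / real n \<le> (\<integral>x. f x \<partial>M) + e j"
          by (auto simp: field_simps sum_negf)
        with j show ?case by (simp add: abs_less_iff)
      qed
      then show "\<exists>no. \<forall>n\<ge>no. norm ((\<Sum>i<n. f ((T ^^ i) x)) / real n - (\<integral>x. f x \<partial>M)) < r"
        by (simp add: eventually_sequentially)
    qed
  qed
qed

text \<open>\<open>f ((T ^^ n) x)\<close> is the difference of two consecutive Birkhoff sums, whose
  averages have the same limit. The offset \<open>r\<close> occurs in the leftover pieces of the
  upper bound.\<close>

lemma iter_over_n_tendsto_0:
  fixes f :: "'a \<Rightarrow> real"
  assumes "integrable M f"
  shows "AE x in M. \<forall>r. (\<lambda>n. f ((T ^^ (n + r)) x) / real n) \<longlonglongrightarrow> 0"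
  using birkhoff[OF assms]
proof eventually_elim
  case (elim x)
  define s where "s n = (\<Sum>i<n. f ((T ^^ i) x)) / real n" for n
  have s: "s \<longlonglongrightarrow> (\<integral>x. f x \<partial>M)" using elim by (simp add: s_def[abs_def])
  have "(\<lambda>n. s (Suc n) * (real (Suc n) / real n) - s n) \<longlonglongrightarrow> (\<integral>x. f x \<partial>M) * 1 - (\<integral>x. f x \<partial>M)"
    by (intro tendsto_intros s LIMSEQ_Suc[OF s] LIMSEQ_Suc_n_over_n)
  moreover have "\<forall>\<^sub>F n in sequentially. s (Suc n) * (real (Suc n) / real n) - s n = f ((T ^^ n) x) / real n"
  proof (intro eventually_sequentiallyI[of 1])
    fix n :: nat assume "1 \<le> n"
    moreover have "s (Suc n) * (real (Suc n) / real n) = (\<Sum>i<Suc n. f ((T ^^ i) x)) / real n"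
      unfolding s_def by (simp del: sum.lessThan_Suc)
    ultimately show "s (Suc n) * (real (Suc n) / real n) - s n = f ((T ^^ n) x) / real n"
      by (simp add: s_def add_divide_distrib)
  qed
  ultimately have *: "(\<lambda>n. f ((T ^^ n) x) / real n) \<longlonglongrightarrow> 0"
    by (simp add: tendsto_cong)
  show ?case
  proof
    fix r
    have "(\<lambda>n. f ((T ^^ (n + r)) x) / real (n + r) * (1 + real r / real n)) \<longlonglongrightarrow> 0 * (1 + 0)"
      by (intro tendsto_intros LIMSEQ_ignore_initial_segment[OF *] lim_const_over_n)
    moreover have "\<forall>\<^sub>F n in sequentially. f ((T ^^ (n + r)) x) / real (n + r) * (1 + real r / real n)
        = f ((T ^^ (n + r)) x) / real n"
    proof (intro eventually_sequentiallyI[of 1])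
      fix n :: nat assume "1 \<le> n"
      then have "1 + real r / real n = real (n + r) / real n"
        by (simp add: field_simps)
      then show "f ((T ^^ (n + r)) x) / real (n + r) * (1 + real r / real n) = f ((T ^^ (n + r)) x) / real n"
        using \<open>1 \<le> n\<close> by simp
    qed
    ultimately show "(\<lambda>n. f ((T ^^ (n + r)) x) / real n) \<longlonglongrightarrow> 0"
      by (simp add: tendsto_cong)
  qed
qed

end

section \<open>The upper bound and Kingman's theorem\<close>

context subadditive_process
begin

text \<open>Summing over the \<open>k\<close> lengths \<open>n, \<dots>, n + k - 1\<close> makes the block decomposition telescope,
  so that the full sum along the orbit appears instead of sums along its residue classes mod \<open>k\<close>.\<close>
lemma sum_window_le:
  assumes x: "x \<in> space M"
  shows "(\<Sum>r<k. g (n + r) x) \<le> (\<Sum>r<k. g r x) + (\<Sum>m<n. g k ((T ^^ m) x))"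
proof (induction n)
  case (Suc n)
  have "(\<Sum>r<k. g (Suc n + r) x) + g n x = (\<Sum>r<Suc k. g (n + r) x)"
    by (subst sum.lessThan_Suc_shift) simp
  also have "\<dots> = (\<Sum>r<k. g (n + r) x) + g (n + k) x"
    by simp
  also have "g (n + k) x \<le> g n x + g k ((T ^^ n) x)"
    using x by (rule g_add)
  finally show ?case using Suc by simp
qed simp

text \<open>For each \<open>r < k\<close> split \<open>n + k\<close> into \<open>n + r\<close> and
  \<open>k - r\<close> and sum over \<open>r\<close>. By \<open>sum_window_le\<close> the first
  parts give a Birkhoff sum of \<open>g k\<close>, and the \<open>k\<close> leftover pieces are
  negligible against \<open>n\<close>. The quantifier over \<open>q\<close> stays inside the
  \<open>AE\<close>, since there are uncountably many \<open>q\<close>.\<close>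

lemma eventually_less:
  assumes k: "k \<ge> 1"
  shows "AE x in M. \<forall>q > (\<integral>x. g k x \<partial>M) / real k. \<forall>\<^sub>F n in sequentially. g n x / real n < q"
proof -
  have "AE x in M. \<forall>s r. (\<lambda>n. g s ((T ^^ (n + r)) x) / real n) \<longlonglongrightarrow> 0"
    unfolding AE_all_countable[where P = "\<lambda>s x. \<forall>r. (\<lambda>n. g s ((T ^^ (n + r)) x) / real n) \<longlonglongrightarrow> 0"]
    by (intro allI iter_over_n_tendsto_0 integrable_g)
  then show ?thesis
    using birkhoff[OF integrable_g[of k]] AE_space
  proof eventually_elim
    case (elim x)
    \<comment> \<open>The bound for \<open>g (n + k) x / real (n + k)\<close>: the last factor
      exchanges division by \<open>n\<close> for division by \<open>n + k\<close>. Of the three sums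
      only the middle one contributes to the limit.\<close>
    define R where "R n = ((\<Sum>r<k. g r x) / real n + (\<Sum>m<n. g k ((T ^^ m) x)) / real n
        + (\<Sum>r<k. g (k - r) ((T ^^ (n + r)) x) / real n)) / real k * (real n / real (n + k))" for n
    have "(\<lambda>n. 1 - real k / real (n + k)) \<longlonglongrightarrow> 1 - 0"
      by (intro tendsto_intros LIMSEQ_ignore_initial_segment[OF lim_const_over_n])
    moreover have "1 - real k / real (n + k) = real n / real (n + k)" for n
      using k by (simp add: field_simps)
    ultimately have "(\<lambda>n. real n / real (n + k)) \<longlonglongrightarrow> 1" by simp
    then have "R \<longlonglongrightarrow> (0 + (\<integral>x. g k x \<partial>M) + (\<Sum>r<k. 0)) / real k * 1"
      unfolding R_def using elim(1) elim(2) k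
      by (intro tendsto_intros lim_const_over_n) auto
    then have R: "R \<longlonglongrightarrow> (\<integral>x. g k x \<partial>M) / real k" by simp
    have le: "g (n + k) x / real (n + k) \<le> R n" if n: "n \<ge> 1" for n
    proof -
      have "real k * g (n + k) x = (\<Sum>r<k. g (n + k) x)" by simp
      also have "\<dots> \<le> (\<Sum>r<k. g (n + r) x + g (k - r) ((T ^^ (n + r)) x))"
        using g_add[OF elim(3), of "n + _" "k - _"] by (intro sum_mono) (metis add.assoc le_add_diff_inverse lessThan_iff less_imp_le)
      also have "\<dots> \<le> (\<Sum>r<k. g r x) + (\<Sum>m<n. g k ((T ^^ m) x)) + (\<Sum>r<k. g (k - r) ((T ^^ (n + r)) x))"
        using sum_window_le[OF elim(3), where n = n and k = k] by (simp add: sum.distrib)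
      also have "\<dots> = R n * real k * real (n + k)"
      proof -
        have "a + b + c = (a / real n + b / real n + c / real n) / real k * (real n / real (n + k)) * real k * real (n + k)"
          for a b c :: real
          using n k by (simp flip: add_divide_distrib)
        then show ?thesis
          unfolding R_def sum_divide_distrib[symmetric] .
      qed
      finally have "real k * g (n + k) x \<le> real k * (R n * real (n + k))"
        by (simp only: ac_simps)
      then have "g (n + k) x \<le> R n * real (n + k)"
        using k by (subst (asm) mult_le_cancel_left_pos) auto
      then show ?thesis
        using n by (subst pos_divide_le_eq) auto
    qed
    show ?case
    proof (intro allI impI)
      fix q assume "q > (\<integral>x. g k x \<partial>M) / real k"
      then have "\<forall>\<^sub>F n in sequentially. R n < q"
        using R by (simp add: order_tendstoD)
      then have "\<forall>\<^sub>F n in sequentially. g (n + k) x / real (n + k) < q"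
        using eventually_ge_at_top[of 1]
        by eventually_elim (use le in fastforce)
      then show "\<forall>\<^sub>F n in sequentially. g n x / real n < q"
        by (rule eventually_sequentially_seg[THEN iffD1])
    qed
  qed
qed

text \<open>One null set serves all margins \<open>1 / (j + 1)\<close> below the infimum and all
  lengths \<open>k\<close> in the upper bound. Boundedness from below makes the real-valued
  \<open>INF\<close> a genuine infimum, so some \<open>k\<close> comes below any
  \<open>q > \<gamma>\<close>.\<close>

theorem kingman:
  assumes bdd: "bdd_below ((\<lambda>n. (\<integral>x. g n x \<partial>M) / real n) ` {1..})"
  shows "AE x in M. (\<lambda>n. g n x / real n) \<longlonglongrightarrow> (INF n\<in>{1..}. (\<integral>x. g n x \<partial>M) / real n)"
proof -
  define \<gamma> where "\<gamma> = (INF n\<in>{1..}. (\<integral>x. g n x \<partial>M) / real n)"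
  have low: "\<gamma> * real n \<le> (\<integral>x. g n x \<partial>M)" if "n \<ge> 1" for n
    using cINF_lower[OF bdd, of n] that by (simp add: \<gamma>_def field_simps)
  have "AE x in M. \<forall>j::nat. \<forall>\<^sub>F n in sequentially. g n x \<ge> (\<gamma> - 1 / (real j + 1)) * real n"
    unfolding AE_all_countable by (intro allI eventually_ge[OF low]) auto
  moreover have "AE x in M. \<forall>k\<in>{1..}. \<forall>q > (\<integral>x. g k x \<partial>M) / real k. \<forall>\<^sub>F n in sequentially. g n x / real n < q"
    using eventually_less by (subst AE_ball_countable) auto
  ultimately show ?thesis
    unfolding \<gamma>_def[symmetric]
  proof eventually_elim
    case (elim x)
    show ?case
    proof (rule order_tendstoI)
      fix q assume "q < \<gamma>"
      then obtain j where j: "1 / (real j + 1) < \<gamma> - q"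
        by (metis diff_gt_0_iff_gt nat_approx_posE of_nat_Suc add.commute)
      show "\<forall>\<^sub>F n in sequentially. q < g n x / real n"
        using elim(1)[rule_format, of j] eventually_ge_at_top[of 1]
      proof eventually_elim
        case (elim n)
        then have "\<gamma> - 1 / (real j + 1) \<le> g n x / real n"
          by (subst pos_le_divide_eq) auto
        with j show ?case by linarith
      qed
    next
      fix q assume "\<gamma> < q"
      then obtain k where "k \<in> {1..}" "(\<integral>x. g k x \<partial>M) / real k < q"
        unfolding \<gamma>_def using cINF_less_iff[OF _ bdd, of q] by auto
      then show "\<forall>\<^sub>F n in sequentially. g n x / real n < q"
        using elim(2) by blast
    qed
  qed
qed

end

subsection \<open>The shift on a product space\<close>

lemma shift_iter: "((\<lambda>\<omega> n. \<omega> (Suc n)) ^^ m) \<omega> = (\<lambda>i. \<omega> (i + m))"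
  by (induction m) auto

text \<open>A strictly invariant set equals each of its preimages under the iterated shift. For
  every \<open>n\<close> it therefore depends only on the coordinates from \<open>n\<close> on,
  which makes it a tail event of the independent coordinates.\<close>

lemma ergodic_shift:
  fixes \<mu> :: "'b measure"
  assumes "prob_space \<mu>"
  shows "ergodic_map (PiM UNIV (\<lambda>_::nat. \<mu>)) (\<lambda>\<omega> n. \<omega> (Suc n))"
proof -
  let ?M = "PiM UNIV (\<lambda>_::nat. \<mu>)" and ?T = "\<lambda>\<omega> n. \<omega> (Suc n) :: 'b"
  interpret \<mu>: prob_space \<mu> by fact
  interpret product_prob_space "\<lambda>_::nat. \<mu>" UNIV ..
  have T [measurable]: "?T \<in> measurable ?M ?M"
    by (rule measurable_PiM_single') (auto simp: space_PiM)
  show ?thesis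
  proof
    show "distr ?M ?M ?T = ?M"
      using distr_PiM_reindex[of UNIV "\<lambda>_. \<mu>" Suc UNIV] assms by (simp add: restrict_UNIV)
  next
    fix A assume A: "A \<in> sets ?M" and inv: "?T -` A \<inter> space ?M = A"
    define X where "X i \<omega> = \<omega> i" for i :: nat and \<omega> :: "nat \<Rightarrow> 'b"
    define F where "F i = sigma_sets (space ?M) {X i -` B \<inter> space ?M |B. B \<in> sets \<mu>}" for i
    \<comment> \<open>The joint map of all coordinates is the identity, so its law is the product of
      the marginals.\<close>
    have indep: "P.indep_vars (\<lambda>_. \<mu>) X UNIV"
      unfolding X_def
      by (subst P.indep_vars_iff_distr_eq_PiM') (auto simp: PiM_component restrict_UNIV distr_id)
    have inv_n: "(?T ^^ n) -` A \<inter> space ?M = A" for n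
    proof (induction n)
      case 0
      then show ?case using sets.sets_into_space[OF A] by auto
    next
      case (Suc n)
      have "(?T ^^ Suc n) -` A \<inter> space ?M = (?T ^^ n) -` (?T -` A \<inter> space ?M) \<inter> space ?M"
        by (auto simp: shift_iter space_PiM PiE_iff)
      then show ?case by (simp only: inv Suc)
    qed
    have tail: "A \<in> P.tail_events F"
      unfolding P.tail_events_def
    proof
      fix n
      let ?G = "sigma (space ?M) (\<Union>(F ` {n..}))"
      have Fsub: "F i \<subseteq> Pow (space ?M)" for i
        unfolding F_def using sigma_sets_into_sp[of "{X i -` B \<inter> space ?M |B. B \<in> sets \<mu>}" "space ?M"] by blast
      have sets_G: "sets ?G = sigma_sets (space ?M) (\<Union>(F ` {n..}))" and space_G: "space ?G = space ?M"
        using Fsub by (auto intro!: sets_measure_of space_measure_of)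
      \<comment> \<open>Every coordinate of the \<open>n\<close>-fold shifted sequence is an
        original coordinate of index at least \<open>n\<close>, and \<open>?G\<close> is generated
        by these.\<close>
      have "(?T ^^ n) \<in> measurable ?G ?M"
      proof (rule measurable_PiM_single')
        have shifted: "\<omega> (i + n) \<in> space \<mu>" if "\<omega> \<in> space ?G" for \<omega> i
          using that unfolding space_G by (auto simp: space_PiM PiE_iff)
        show "(?T ^^ n) \<in> space ?G \<rightarrow> (UNIV \<rightarrow>\<^sub>E space \<mu>)"
          by (simp add: PiE_UNIV_domain Pi_iff shift_iter shifted del: space_measure_of_conv)
        fix i
        show "(\<lambda>\<omega>. (?T ^^ n) \<omega> i) \<in> measurable ?G \<mu>"
        proof (rule measurableI)
          fix B assume "B \<in> sets \<mu>"
          then have "X (i + n) -` B \<inter> space ?M \<in> F (i + n)"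
            unfolding F_def by auto
          then show "(\<lambda>\<omega>. (?T ^^ n) \<omega> i) -` B \<inter> space ?G \<in> sets ?G"
            unfolding sets_G space_G
              by (intro sigma_sets.Basic UN_I[of "i + n"]) (auto simp: shift_iter X_def[abs_def])
        next
          fix \<omega> assume "\<omega> \<in> space ?G"
          then show "(?T ^^ n) \<omega> i \<in> space \<mu>"
            unfolding shift_iter by (rule shifted)
        qed
      qed
      from measurable_sets[OF this A] show "A \<in> sigma_sets (space ?M) (\<Union>(F ` {n..}))"
        unfolding sets_G space_G by (simp only: inv_n)
    qed
    have "sigma_algebra (space ?M) (F i)" for i
      unfolding F_def by (rule sigma_algebra_sigma_sets) auto
    moreover have "P.indep_sets F UNIV"
      using indep unfolding P.indep_vars_def F_def[abs_def] by blast
    ultimately show "P.prob A = 0 \<or> P.prob A = 1"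
      using tail by (rule P.kolmogorov_0_1_law)
  qed (rule T)
qed

section \<open>Degrees of compositions\<close>

subsection \<open>Substitution into polynomials\<close>

definition subst_mon :: "rmap \<Rightarrow> (nat \<Rightarrow>\<^sub>0 nat) \<Rightarrow> mpoly" where
  "subst_mon F m = (\<Prod>i\<in>Poly_Mapping.keys m. F i ^ Poly_Mapping.lookup m i)"

lemma subst_alt: "subst H F = (\<Sum>m\<in>Poly_Mapping.keys H. Poly_Mapping.single 0 (Poly_Mapping.lookup H m) * subst_mon F m)"
  by (simp add: subst_def subst_mon_def)

text \<open>Serves to index several monomials by one finite set, the extra factors being 1;
  \<open>subst_superset\<close> does the same for sums.\<close>

lemma subst_mon_superset:
  assumes "finite A" "Poly_Mapping.keys m \<subseteq> A"
  shows "subst_mon F m = (\<Prod>i\<in>A. F i ^ Poly_Mapping.lookup m i)"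
  unfolding subst_mon_def using assms by (intro prod.mono_neutral_left) (auto simp: in_keys_iff)

lemma subst_mon_0 [simp]: "subst_mon F 0 = 1"
  by (simp add: subst_mon_def)

lemma subst_mon_add: "subst_mon F (m + n) = subst_mon F m * subst_mon F n"
proof -
  let ?A = "Poly_Mapping.keys m \<union> Poly_Mapping.keys n"
  have "Poly_Mapping.keys (m + n) \<subseteq> ?A" by (rule keys_add)
  then show ?thesis
    by (simp add: subst_mon_superset[of ?A] lookup_add power_add prod.distrib)
qed

lemma subst_superset:
  assumes "finite A" "Poly_Mapping.keys H \<subseteq> A"
  shows "subst H F = (\<Sum>m\<in>A. Poly_Mapping.single 0 (Poly_Mapping.lookup H m) * subst_mon F m)"
  unfolding subst_alt using assms by (intro sum.mono_neutral_left) (auto simp: in_keys_iff)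

lemma subst_zero [simp]: "subst 0 F = 0"
  by (simp add: subst_alt)

lemma subst_add: "subst (H + K) F = subst H F + subst K F"
proof -
  let ?A = "Poly_Mapping.keys H \<union> Poly_Mapping.keys K"
  have "Poly_Mapping.keys (H + K) \<subseteq> ?A" by (rule keys_add)
  then show ?thesis
    by (simp add: subst_superset[of ?A] lookup_add single_add distrib_right sum.distrib)
qed

lemma subst_single [simp]: "subst (Poly_Mapping.single m c) F = Poly_Mapping.single 0 c * subst_mon F m"
  by (cases "c = 0") (simp_all add: subst_alt)

lemma subst_sum: "subst (sum h A) F = (\<Sum>x\<in>A. subst (h x) F)"
  by (induction A rule: infinite_finite_induct) (simp_all add: subst_add)

lemma poly_mapping_sum_single:
  fixes H :: "'a \<Rightarrow>\<^sub>0 'b :: comm_monoid_add"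
  shows "(\<Sum>m\<in>Poly_Mapping.keys H. Poly_Mapping.single m (Poly_Mapping.lookup H m)) = H"
  by (rule poly_mapping_eqI) (simp add: lookup_sum lookup_single when_def in_keys_iff)

text \<open>Both sides are bilinear, so expanding \<open>H\<close> and \<open>K\<close> into
  monomials reduces the claim to \<open>subst_mon_add\<close>.\<close>

lemma subst_mult: "subst (H * K) F = subst H F * subst K F"
proof -
  let ?s = "\<lambda>H m. Poly_Mapping.single m (Poly_Mapping.lookup H m)"
  have "H * K = (\<Sum>m\<in>Poly_Mapping.keys H. \<Sum>n\<in>Poly_Mapping.keys K. ?s H m * ?s K n)"
    by (simp add: poly_mapping_sum_single flip: sum_product)
  then have "subst (H * K) F = (\<Sum>m\<in>Poly_Mapping.keys H. \<Sum>n\<in>Poly_Mapping.keys K. subst (?s H m * ?s K n) F)"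
    by (simp only: subst_sum)
  also have "\<dots> = (\<Sum>m\<in>Poly_Mapping.keys H. \<Sum>n\<in>Poly_Mapping.keys K. subst (?s H m) F * subst (?s K n) F)"
  proof (intro sum.cong refl)
    fix m n
    have "Poly_Mapping.single 0 (a * b :: complex) = Poly_Mapping.single 0 a * Poly_Mapping.single (0::nat \<Rightarrow>\<^sub>0 nat) b" for a b
      by (simp add: mult_single)
    then show "subst (?s H m * ?s K n) F = subst (?s H m) F * subst (?s K n) F"
      by (simp add: mult_single subst_mon_add mult_ac)
  qed
  also have "\<dots> = subst H F * subst K F"
    by (simp add: subst_alt[of H] subst_alt[of K] flip: sum_product)
  finally show ?thesis .
qed

lemma subst_const [simp]: "subst (Poly_Mapping.single 0 c) F = Poly_Mapping.single 0 c"
  by simp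

lemma subst_one [simp]: "subst 1 F = 1"
  using subst_const[of 1 F] by (simp del: subst_const subst_single)

lemma subst_power: "subst (H ^ n) F = subst H F ^ n"
  by (induction n) (simp_all add: subst_mult)

lemma subst_prod: "subst (prod h A) F = (\<Prod>x\<in>A. subst (h x) F)"
  by (induction A rule: infinite_finite_induct) (simp_all add: subst_mult)

lemma subst_var [simp]: "subst (var i) F = F i"
  by (simp add: var_def subst_mon_def)

text \<open>Substituting \<open>G\<close> is a ring homomorphism fixing the constants, so it passes
  through the sums and products that build \<open>subst H F\<close>. This is the associativity of
  composition.\<close>

lemma subst_subst: "subst (subst H F) G = subst H (\<lambda>i. subst (F i) G)"
  unfolding subst_def[of H]
  by (simp add: subst_sum subst_mult subst_prod subst_power)

lemma var_power: "var i ^ n = Poly_Mapping.single (Poly_Mapping.single i n) 1"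
  by (induction n) (simp_all add: var_def mult_single flip: single_add)

lemma prod_single_one:
  "(\<Prod>i\<in>A. Poly_Mapping.single (h i) (1 :: 'b :: comm_semiring_1)) = Poly_Mapping.single (\<Sum>i\<in>A. h i :: 'a :: comm_monoid_add) 1"
  by (induction A rule: infinite_finite_induct) (simp_all add: mult_single)

lemma subst_mon_var: "subst_mon var m = Poly_Mapping.single m 1"
  by (simp add: subst_mon_def var_power prod_single_one poly_mapping_sum_single)

lemma subst_id: "subst H var = H"
  by (simp add: subst_alt subst_mon_var mult_single poly_mapping_sum_single)

subsection \<open>Homogeneity\<close>

definition mon_deg :: "(nat \<Rightarrow>\<^sub>0 nat) \<Rightarrow> nat" where
  "mon_deg m = (\<Sum>i\<in>Poly_Mapping.keys m. Poly_Mapping.lookup m i)"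

lemma mon_deg_superset:
  assumes "finite A" "Poly_Mapping.keys m \<subseteq> A"
  shows "mon_deg m = (\<Sum>i\<in>A. Poly_Mapping.lookup m i)"
  unfolding mon_deg_def using assms by (intro sum.mono_neutral_left) (auto simp: in_keys_iff)

lemma mon_deg_add: "mon_deg (m + n) = mon_deg m + mon_deg n"
proof -
  let ?A = "Poly_Mapping.keys m \<union> Poly_Mapping.keys n"
  have "Poly_Mapping.keys (m + n) \<subseteq> ?A" by (rule keys_add)
  then show ?thesis
    by (simp add: mon_deg_superset[of ?A] lookup_add sum.distrib)
qed

definition mons :: "nat \<Rightarrow> nat \<Rightarrow> (nat \<Rightarrow>\<^sub>0 nat) set" where
  "mons N d = {m. Poly_Mapping.keys m \<subseteq> {..N} \<and> mon_deg m = d}"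

lemma homog_iff: "homog N d H \<longleftrightarrow> Poly_Mapping.keys H \<subseteq> mons N d"
  by (auto simp: homog_def in_vars_def mons_def mon_deg_def)

lemma mons_add: "m \<in> mons N d \<Longrightarrow> n \<in> mons N e \<Longrightarrow> m + n \<in> mons N (d + e)"
  using keys_add[of m n] by (auto simp: mons_def mon_deg_add)

lemma homog_mult: "homog N d H \<Longrightarrow> homog N e K \<Longrightarrow> homog N (d + e) (H * K)"
  unfolding homog_iff using keys_mult[of H K] by (force intro: mons_add)

lemma homog_zero [simp]: "homog N d 0"
  by (simp add: homog_iff)

lemma homog_add: "homog N d H \<Longrightarrow> homog N d K \<Longrightarrow> homog N d (H + K)"
  unfolding homog_iff using keys_add[of H K] by blast

lemma homog_sum: "(\<And>x. x \<in> A \<Longrightarrow> homog N d (h x)) \<Longrightarrow> homog N d (sum h A)"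
  by (induction A rule: infinite_finite_induct) (auto intro: homog_add)

lemma homog_const [simp]: "homog N 0 (Poly_Mapping.single 0 c)"
  by (simp add: homog_iff mons_def mon_deg_def)

lemma homog_one [simp]: "homog N 0 1"
  using homog_const[of N 1] by (simp del: homog_const)

lemma homog_power: "homog N d H \<Longrightarrow> homog N (n * d) (H ^ n)"
  by (induction n) (auto intro: homog_mult)

lemma homog_prod: "(\<And>x. x \<in> A \<Longrightarrow> homog N (d x) (h x)) \<Longrightarrow> homog N (\<Sum>x\<in>A. d x) (prod h A)"
  by (induction A rule: infinite_finite_induct) (auto intro: homog_mult)

lemma homog_subst_mon:
  assumes "m \<in> mons N d" "\<And>i. i \<le> N \<Longrightarrow> homog N e (F i)"
  shows "homog N (d * e) (subst_mon F m)"
proof -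
  have "homog N (\<Sum>i\<in>Poly_Mapping.keys m. Poly_Mapping.lookup m i * e) (subst_mon F m)"
    unfolding subst_mon_def using assms by (intro homog_prod homog_power) (auto simp: mons_def)
  also have "(\<Sum>i\<in>Poly_Mapping.keys m. Poly_Mapping.lookup m i * e) = d * e"
    using assms by (simp add: mons_def mon_deg_def flip: sum_distrib_right)
  finally show ?thesis .
qed

lemma homog_subst:
  assumes "homog N d H" "\<And>i. i \<le> N \<Longrightarrow> homog N e (F i)"
  shows "homog N (d * e) (subst H F)"
  unfolding subst_alt
proof (rule homog_sum)
  fix m assume "m \<in> Poly_Mapping.keys H"
  then have "homog N (0 + d * e) (Poly_Mapping.single 0 (Poly_Mapping.lookup H m) * subst_mon F m)"
    using assms by (intro homog_mult homog_subst_mon homog_const) (auto simp: homog_iff)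
  then show "homog N (d * e) (Poly_Mapping.single 0 (Poly_Mapping.lookup H m) * subst_mon F m)"
    by simp
qed

lemma homog_var: "i \<le> N \<Longrightarrow> homog N 1 (var i)"
  by (simp add: homog_iff var_def mons_def mon_deg_def)

lemma in_vars_mult: "in_vars N H \<Longrightarrow> in_vars N K \<Longrightarrow> in_vars N (H * K)"
  unfolding in_vars_def using keys_mult[of H K] by (fastforce dest!: keys_add[THEN subsetD])

lemma in_vars_add: "in_vars N H \<Longrightarrow> in_vars N K \<Longrightarrow> in_vars N (H + K)"
  unfolding in_vars_def using keys_add[of H K] by blast

lemma in_vars_zero [simp]: "in_vars N 0"
  by (simp add: in_vars_def)

lemma in_vars_const [simp]: "in_vars N (Poly_Mapping.single 0 c)"
  by (simp add: in_vars_def)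

lemma in_vars_one [simp]: "in_vars N 1"
  by (simp add: in_vars_def)

lemma in_vars_sum: "(\<And>x. x \<in> A \<Longrightarrow> in_vars N (h x)) \<Longrightarrow> in_vars N (sum h A)"
  by (induction A rule: infinite_finite_induct) (auto intro: in_vars_add)

lemma in_vars_power: "in_vars N H \<Longrightarrow> in_vars N (H ^ n)"
  by (induction n) (auto intro: in_vars_mult)

lemma in_vars_prod: "(\<And>x. x \<in> A \<Longrightarrow> in_vars N (h x)) \<Longrightarrow> in_vars N (prod h A)"
  by (induction A rule: infinite_finite_induct) (auto intro: in_vars_mult)

lemma in_vars_subst: "in_vars N H \<Longrightarrow> (\<And>i. i \<le> N \<Longrightarrow> in_vars N (F i)) \<Longrightarrow> in_vars N (subst H F)"
  unfolding subst_def
  by (intro in_vars_sum in_vars_mult in_vars_const in_vars_prod in_vars_power) (auto simp: in_vars_def)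

lemma homog_in_vars: "homog N d H \<Longrightarrow> in_vars N H"
  by (simp add: homog_def)

text \<open>Homogeneity turns a common factor of the arguments into its \<open>d\<close>-th power,
  so both sides are \<open>H\<close> at the same tuple. This compares two representatives of one
  rational map without division.\<close>

lemma subst_proportional:
  assumes H: "homog N d H" and uv: "\<And>i. i \<le> N \<Longrightarrow> u * F i = v * G i"
  shows "u ^ d * subst H F = v ^ d * subst H G"
proof -
  have scale: "w ^ d * subst_mon K m = (\<Prod>i\<in>Poly_Mapping.keys m. (w * K i) ^ Poly_Mapping.lookup m i)"
    if "m \<in> mons N d" for w K m
    using that unfolding subst_mon_def mons_def mon_deg_def
    by (auto simp: power_mult_distrib prod.distrib power_sum)
  have "u ^ d * subst_mon F m = v ^ d * subst_mon G m" if "m \<in> Poly_Mapping.keys H" for m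
  proof -
    have "m \<in> mons N d" using that H by (auto simp: homog_iff)
    moreover from this have "Poly_Mapping.keys m \<subseteq> {..N}" by (simp add: mons_def)
    ultimately show ?thesis
      by (simp only: scale) (intro prod.cong refl, simp add: uv subset_eq)
  qed
  then show ?thesis
    by (simp add: subst_alt sum_distrib_left mult.left_commute[of "_ ^ d"] cong: sum.cong)
qed

subsection \<open>The degree of a rational map\<close>

definition dom_rep :: "nat \<Rightarrow> rmap \<Rightarrow> bool" where
  "dom_rep N F \<longleftrightarrow> (\<exists>d. rep N F d) \<and> dominant N F"

lemma rdeg_attained:
  assumes "rep N F d"
  shows "\<exists>G. rep N G (rdeg N F) \<and> same_map N F G"
proof -
  have "\<exists>d G. rep N G d \<and> same_map N F G"
    using assms by (intro exI[of _ d] exI[of _ F]) (simp add: same_map_def mult.commute)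
  then show ?thesis
    unfolding rdeg_def by (rule LeastI_ex)
qed

lemma rdeg_le: "rep N G d \<Longrightarrow> same_map N F G \<Longrightarrow> rdeg N F \<le> d"
  unfolding rdeg_def by (rule Least_le) auto

lemma var_nonzero: "var i \<noteq> 0"
proof
  assume "var i = 0"
  then have "Poly_Mapping.lookup (var i) (Poly_Mapping.single i 1) = 0" by simp
  then show False by (simp add: var_def)
qed

lemma dominantD: "dominant N F \<Longrightarrow> in_vars N H \<Longrightarrow> subst H F = 0 \<Longrightarrow> H = 0"
  by (simp add: dominant_def)

lemma dominant_nonzero:
  assumes "dominant N F" "i \<le> N"
  shows "F i \<noteq> 0"
proof
  assume "F i = 0"
  then have "var i = 0"
    using dominantD[OF assms(1) homog_in_vars[OF homog_var[OF assms(2)]]] by simp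
  then show False by (simp add: var_nonzero)
qed

lemma rep_homog: "rep N F d \<Longrightarrow> i \<le> N \<Longrightarrow> homog N d (F i)"
  by (simp add: rep_def)

lemma rep_in_vars: "rep N F d \<Longrightarrow> i \<le> N \<Longrightarrow> in_vars N (F i)"
  by (rule homog_in_vars[OF rep_homog])

text \<open>Dominance of \<open>\<phi>\<close> is used twice: it keeps a component of the
  composition nonzero, and it cancels \<open>\<phi>\<close> from an algebraic relation, leaving a
  relation between the components of \<open>\<psi>\<close>.\<close>

lemma dom_rep_rcomp:
  assumes "dom_rep N \<psi>" "dom_rep N \<phi>"
  shows "dom_rep N (rcomp \<psi> \<phi>)"
proof -
  obtain d e where d: "rep N \<psi> d" and e: "rep N \<phi> e" and dom: "dominant N \<psi>" "dominant N \<phi>"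
    using assms by (auto simp: dom_rep_def)
  obtain i where i: "i \<le> N" "\<psi> i \<noteq> 0" using d by (auto simp: rep_def)
  have "subst (\<psi> i) \<phi> \<noteq> 0"
    using dominantD[OF dom(2) rep_in_vars[OF d i(1)]] i(2) by metis
  moreover have "homog N (d * e) (subst (\<psi> i) \<phi>)" if "i \<le> N" for i
    by (rule homog_subst[OF rep_homog[OF d that] rep_homog[OF e]])
  ultimately have "rep N (rcomp \<psi> \<phi>) (d * e)"
    using i by (auto simp: rep_def rcomp_def)
  moreover have "dominant N (rcomp \<psi> \<phi>)"
    unfolding dominant_def
  proof (intro allI impI)
    fix H assume H: "in_vars N H" and "subst H (rcomp \<psi> \<phi>) = 0"
    then have 0: "subst (subst H \<psi>) \<phi> = 0"
      by (simp add: subst_subst rcomp_def)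
    have "in_vars N (subst H \<psi>)"
      by (rule in_vars_subst[OF H rep_in_vars[OF d]])
    then have "subst H \<psi> = 0" using 0 by (rule dominantD[OF dom(2)])
    with H show "H = 0" by (rule dominantD[OF dom(1)])
  qed
  ultimately show ?thesis by (auto simp: dom_rep_def)
qed

text \<open>Composing representatives of least degree gives a tuple of the product degree. It may
  have common factors, whence only an inequality. The work lies in showing that it represents the
  same map.\<close>

lemma rdeg_rcomp_le:
  assumes "dom_rep N \<psi>" "dom_rep N \<phi>"
  shows "rdeg N (rcomp \<psi> \<phi>) \<le> rdeg N \<psi> * rdeg N \<phi>"
proof -
  let ?d = "rdeg N \<psi>" and ?e = "rdeg N \<phi>"
  obtain \<psi>' where \<psi>': "rep N \<psi>' ?d" "same_map N \<psi> \<psi>'"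
    using assms(1) rdeg_attained unfolding dom_rep_def by blast
  obtain \<phi>' where \<phi>': "rep N \<phi>' ?e" "same_map N \<phi> \<phi>'"
    using assms(2) rdeg_attained unfolding dom_rep_def by blast
  have dom: "dominant N \<phi>" using assms by (simp add: dom_rep_def)
  \<comment> \<open>By \<open>same_map\<close> at index 0,
    \<open>u * \<phi> i = v * \<phi>' i\<close>, the proportionality that
    \<open>subst_proportional\<close> requires.\<close>
  define u v where "u = \<phi>' 0" and "v = \<phi> 0"
  have v: "v \<noteq> 0" using dominant_nonzero[OF dom] by (simp add: v_def)
  have hom': "homog N ?d (\<psi>' i)" if "i \<le> N" for i
    using \<psi>' that by (simp add: rep_def)
  have uv: "u ^ ?d * subst H \<phi> = v ^ ?d * subst H \<phi>'" if "homog N ?d H" for H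
    using that
  proof (rule subst_proportional)
    show "u * \<phi> i = v * \<phi>' i" if "i \<le> N" for i
      using \<phi>'(2) that by (simp add: u_def v_def same_map_def mult.commute)
  qed
  have u: "u \<noteq> 0"
  proof -
    obtain k where k: "k \<le> N" "\<phi>' k \<noteq> 0" using \<phi>'(1) by (auto simp: rep_def)
    have "\<phi> 0 * \<phi>' k = \<phi> k * \<phi>' 0" using \<phi>'(2) k(1) by (simp add: same_map_def)
    then show ?thesis using k v by (auto simp: u_def v_def)
  qed
  show ?thesis
  proof (rule rdeg_le)
    obtain i where i: "i \<le> N" "\<psi>' i \<noteq> 0" using \<psi>'(1) by (auto simp: rep_def)
    \<comment> \<open>Dominance is available for \<open>\<phi>\<close>, so nonvanishing is shown
      there first and then carried to \<open>\<phi>'\<close> by \<open>uv\<close>.\<close>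
    then have "subst (\<psi>' i) \<phi> \<noteq> 0"
      using dominantD[OF dom homog_in_vars[OF hom'[OF i(1)]]] i(2) by metis
    then have "subst (\<psi>' i) \<phi>' \<noteq> 0"
      using uv[OF hom'[OF i(1)]] u by auto
    then show "rep N (rcomp \<psi>' \<phi>') (?d * ?e)"
      using i homog_subst[OF hom' rep_homog[OF \<phi>'(1)]] by (auto simp: rep_def rcomp_def)
    show "same_map N (rcomp \<psi> \<phi>) (rcomp \<psi>' \<phi>')"
      unfolding same_map_def rcomp_def
    proof (intro allI impI)
      fix i j assume ij: "i \<le> N" "j \<le> N"
      \<comment> \<open>After multiplication by \<open>v ^ ?d\<close> only \<open>\<phi>\<close> is
        substituted, and the cross relation between \<open>\<psi>\<close> and \<open>\<psi>'\<close>
        applies.\<close>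
      have *: "v ^ ?d * (subst (\<psi> i) \<phi> * subst (\<psi>' j) \<phi>') = u ^ ?d * subst (\<psi> i * \<psi>' j) \<phi>"
        if "j \<le> N" for i j
        using uv[OF hom'[OF that]] by (simp add: subst_mult mult.left_commute)
      have "\<psi> i * \<psi>' j = \<psi> j * \<psi>' i"
        using \<psi>'(2) ij by (simp add: same_map_def)
      then have "v ^ ?d * (subst (\<psi> i) \<phi> * subst (\<psi>' j) \<phi>') = v ^ ?d * (subst (\<psi> j) \<phi> * subst (\<psi>' i) \<phi>')"
        using *[of j i] *[of i j] ij by simp
      then show "subst (\<psi> i) \<phi> * subst (\<psi>' j) \<phi>' = subst (\<psi> j) \<phi> * subst (\<psi>' i) \<phi>'"
        using v by simp
    qed
  qed
qed

text \<open>A representative of degree 0 is constant, which forces a linear relation between two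
  components of \<open>F\<close>, against dominance; \<open>N \<ge> 1\<close> provides the second
  component. The bound makes the logarithms of degrees nonnegative.\<close>

lemma rdeg_ge_1:
  assumes N: "N \<ge> 1" and F: "dom_rep N F"
  shows "rdeg N F \<ge> 1"
proof (rule ccontr)
  assume "\<not> rdeg N F \<ge> 1"
  then have deg: "rdeg N F = 0" by simp
  obtain d where "rep N F d" using F by (auto simp: dom_rep_def)
  with rdeg_attained[OF this] deg obtain G where G: "rep N G 0" "same_map N F G"
    by auto
  have dom: "dominant N F" using F by (simp add: dom_rep_def)
  obtain i where i: "i \<le> N" "G i \<noteq> 0" using G(1) by (auto simp: rep_def)
  define j :: nat where "j = (if i = 0 then 1 else 0)"
  have j: "j \<le> N" "j \<noteq> i" using N by (auto simp: j_def)
  have const: "\<exists>c. G k = Poly_Mapping.single 0 c" if "k \<le> N" for k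
  proof -
    have "Poly_Mapping.keys (G k) \<subseteq> mons N 0"
      using G(1) that by (simp add: rep_def homog_iff)
    also have "mons N 0 \<subseteq> {0}"
      by (auto simp: mons_def mon_deg_def in_keys_iff intro!: poly_mapping_eqI)
    finally have "G k = Poly_Mapping.single 0 (Poly_Mapping.lookup (G k) 0)"
      by (intro poly_mapping_eqI) (auto simp: lookup_single when_def in_keys_iff subset_eq)
    then show ?thesis ..
  qed
  obtain a b where ab: "G i = Poly_Mapping.single 0 a" "G j = Poly_Mapping.single 0 b"
    using const i j by blast
  have a: "a \<noteq> 0" using ab i by auto
  \<comment> \<open>The linear form \<open>a X_j - b X_i\<close>, whose coefficient at
    \<open>X_j\<close> is nonzero.\<close>
  define H where "H = G i * var j + Poly_Mapping.single 0 (-b) * var i"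
  have "subst H F = G i * F j - G j * F i"
    by (simp add: H_def subst_add subst_mult ab) (simp add: single_uminus)
  also have "\<dots> = 0"
    using G(2) i j by (simp add: same_map_def mult.commute)
  finally have "subst H F = 0" .
  moreover have "in_vars N H"
    unfolding H_def ab using i j
    by (intro in_vars_add in_vars_mult in_vars_const homog_in_vars[OF homog_var])
  ultimately have "H = 0" using dom by (auto simp: dominant_def)
  moreover have "Poly_Mapping.lookup H (Poly_Mapping.single j 1) = a"
  proof -
    have "Poly_Mapping.single i (1::nat) \<noteq> Poly_Mapping.single j 1"
      using j(2) by (metis keys_single one_neq_zero singleton_inject)
    then show ?thesis
      by (simp add: H_def ab var_def mult_single lookup_add lookup_single when_def)
  qed
  ultimately show False using a by simp
qed

lemma rep_var: "rep N var 1"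
  using homog_var by (auto simp: rep_def var_nonzero)

lemma dom_rep_var: "dom_rep N var"
  using rep_var by (auto simp: dom_rep_def dominant_def subst_id)

lemma dom_rep_gamma: "(\<And>i. i < n \<Longrightarrow> dom_rep N (th i)) \<Longrightarrow> dom_rep N (gamma th n)"
  by (induction n) (auto intro: dom_rep_rcomp dom_rep_var)

text \<open>The cocycle identity over the shift, with the later maps as the outer factor; with
  \<open>rdeg_rcomp_le\<close> it yields subadditivity.\<close>

lemma gamma_add: "gamma th (m + n) = rcomp (gamma (\<lambda>i. th (m + i)) n) (gamma th m)"
  by (induction n) (simp_all add: rcomp_def subst_subst)

lemma rdeg_gamma_add_le:
  assumes "\<And>i. i < m + n \<Longrightarrow> dom_rep N (th i)"
  shows "rdeg N (gamma th (m + n)) \<le> rdeg N (gamma (\<lambda>i. th (m + i)) n) * rdeg N (gamma th m)"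
  unfolding gamma_add using assms by (intro rdeg_rcomp_le dom_rep_gamma) auto

lemma rdeg_var: "N \<ge> 1 \<Longrightarrow> rdeg N var = 1"
proof (rule antisym)
  show "rdeg N var \<le> 1"
    by (rule rdeg_le[OF rep_var]) (simp add: same_map_def mult.commute)
qed (use rdeg_ge_1 dom_rep_var in blast)

lemma gamma_cong: "(\<And>i. i < n \<Longrightarrow> th i = th' i) \<Longrightarrow> gamma th n = gamma th' n"
  by (induction n) simp_all

subsection \<open>Measurability of the degree\<close>

text \<open>A finitely supported function is determined by its graph over the support, a finite
  subset of a countable set. Applied to exponent vectors, it makes quantifiers over monomials
  countable, hence compatible with measurability.\<close>

instance poly_mapping :: (countable, "{countable, zero}") countable
proof
  let ?f = "\<lambda>p :: 'a \<Rightarrow>\<^sub>0 'b. (\<lambda>k. (k, Poly_Mapping.lookup p k)) ` Poly_Mapping.keys p"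
  have inj: "inj ?f"
  proof (rule injI, rule poly_mapping_eqI)
    fix p q :: "'a \<Rightarrow>\<^sub>0 'b" and k assume eq: "?f p = ?f q"
    have "(k, v) \<in> ?f p \<longleftrightarrow> Poly_Mapping.lookup p k = v \<and> v \<noteq> 0" for p :: "'a \<Rightarrow>\<^sub>0 'b" and v
      by (auto simp: in_keys_iff)
    with eq show "Poly_Mapping.lookup p k = Poly_Mapping.lookup q k" by metis
  qed
  have "countable (range ?f)"
    by (rule countable_subset[OF _ countable_Collect_finite]) auto
  then have "countable (UNIV :: ('a \<Rightarrow>\<^sub>0 'b) set)"
    using inj by (rule countable_image_inj_on)
  then show "\<exists>to_nat :: ('a \<Rightarrow>\<^sub>0 'b) \<Rightarrow> nat. inj to_nat"
    by (auto simp: countable_def)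
qed

text \<open>Measurability is tested on each coefficient, so no sigma-algebra on polynomials has to
  be chosen.\<close>

definition coeff_meas :: "'x measure \<Rightarrow> ('x \<Rightarrow> mpoly) \<Rightarrow> bool" where
  "coeff_meas M f \<longleftrightarrow> (\<forall>m. (\<lambda>x. Poly_Mapping.lookup (f x) m) \<in> borel_measurable M)"

lemma coeff_measD [measurable_dest]: "coeff_meas M f \<Longrightarrow> (\<lambda>x. Poly_Mapping.lookup (f x) m) \<in> borel_measurable M"
  by (simp add: coeff_meas_def)

lemma coeff_meas_const: "coeff_meas M (\<lambda>x. c)"
  by (simp add: coeff_meas_def)

lemma coeff_meas_add: "coeff_meas M f \<Longrightarrow> coeff_meas M g \<Longrightarrow> coeff_meas M (\<lambda>x. f x + g x)"
  unfolding coeff_meas_def lookup_add by (intro allI borel_measurable_add) auto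

lemma coeff_meas_single:
  "c \<in> borel_measurable M \<Longrightarrow> coeff_meas M (\<lambda>x. Poly_Mapping.single m (c x))"
  by (simp add: coeff_meas_def lookup_single when_def)

lemma coeff_meas_sum: "(\<And>i. i \<in> A \<Longrightarrow> coeff_meas M (f i)) \<Longrightarrow> coeff_meas M (\<lambda>x. \<Sum>i\<in>A. f i x)"
  by (induction A rule: infinite_finite_induct) (auto intro: coeff_meas_add coeff_meas_const)

text \<open>There are only countably many finite sets of monomials, and having a given support is a
  countable conjunction of conditions on coefficients.\<close>

lemma measurable_keys:
  assumes [measurable]: "coeff_meas M f"
  shows "(\<lambda>x. Poly_Mapping.keys (f x)) \<in> measurable M (count_space (Collect finite))"
proof (subst measurable_count_space_eq_countable[OF countable_Collect_finite], intro conjI ballI)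
  fix A :: "(nat \<Rightarrow>\<^sub>0 nat) set"
  have "(\<lambda>x. Poly_Mapping.keys (f x)) -` {A} \<inter> space M
      = {x \<in> space M. \<forall>m. Poly_Mapping.lookup (f x) m \<noteq> 0 \<longleftrightarrow> m \<in> A}"
    by (auto simp: in_keys_iff)
  also have "\<dots> \<in> sets M" by measurable
  finally show "(\<lambda>x. Poly_Mapping.keys (f x)) -` {A} \<inter> space M \<in> sets M" .
qed auto

text \<open>Products and substitutions sum over a support that varies with \<open>x\<close>.
  Freezing it to a finite set \<open>A\<close> and gluing the countably many cases reduces them to
  sums over fixed sets.\<close>

lemma coeff_meas_compose_keys:
  assumes f: "coeff_meas M f" and h: "\<And>A. finite A \<Longrightarrow> coeff_meas M (h A)"
  shows "coeff_meas M (\<lambda>x. h (Poly_Mapping.keys (f x)) x)"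
  unfolding coeff_meas_def
proof
  fix m
  show "(\<lambda>x. Poly_Mapping.lookup (h (Poly_Mapping.keys (f x)) x) m) \<in> borel_measurable M"
    by (rule measurable_compose_countable'[where f = "\<lambda>A x. Poly_Mapping.lookup (h A x) m",
          OF coeff_measD[OF h] measurable_keys[OF f] countable_Collect_finite]) auto
qed

lemma coeff_meas_mult:
  assumes f: "coeff_meas M f" and g: "coeff_meas M g"
  shows "coeff_meas M (\<lambda>x. f x * g x)"
proof -
  let ?h = "\<lambda>A B x. \<Sum>a\<in>A. \<Sum>b\<in>B. Poly_Mapping.single (a + b) (Poly_Mapping.lookup (f x) a * Poly_Mapping.lookup (g x) b)"
  have "f x * g x = ?h (Poly_Mapping.keys (f x)) (Poly_Mapping.keys (g x)) x" for x
  proof -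
    have "f x * g x = (\<Sum>a\<in>Poly_Mapping.keys (f x). Poly_Mapping.single a (Poly_Mapping.lookup (f x) a))
        * (\<Sum>b\<in>Poly_Mapping.keys (g x). Poly_Mapping.single b (Poly_Mapping.lookup (g x) b))"
      by (simp only: poly_mapping_sum_single)
    then show ?thesis by (simp only: sum_product mult_single)
  qed
  moreover have "coeff_meas M (\<lambda>x. ?h (Poly_Mapping.keys (f x)) (Poly_Mapping.keys (g x)) x)"
    using f g
    by (intro coeff_meas_compose_keys[where h = "\<lambda>A x. ?h A (Poly_Mapping.keys (g x)) x"]
        coeff_meas_compose_keys[where h = "\<lambda>B. ?h _ B"] coeff_meas_sum coeff_meas_single
        borel_measurable_times coeff_measD)
  ultimately show ?thesis by simp
qed

lemma coeff_meas_power: "coeff_meas M f \<Longrightarrow> coeff_meas M (\<lambda>x. f x ^ n)"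
  by (induction n) (auto intro: coeff_meas_mult coeff_meas_const)

lemma coeff_meas_prod: "(\<And>i. i \<in> A \<Longrightarrow> coeff_meas M (f i)) \<Longrightarrow> coeff_meas M (\<lambda>x. \<Prod>i\<in>A. f i x)"
  by (induction A rule: infinite_finite_induct) (auto intro: coeff_meas_mult coeff_meas_const)

lemma coeff_meas_subst:
  assumes H: "coeff_meas M H" and F: "\<And>i. coeff_meas M (\<lambda>x. F x i)"
  shows "coeff_meas M (\<lambda>x. subst (H x) (F x))"
  unfolding subst_def
  by (rule coeff_meas_compose_keys[where h = "\<lambda>A x. \<Sum>m\<in>A. Poly_Mapping.single 0 (Poly_Mapping.lookup (H x) m) *
        (\<Prod>i\<in>Poly_Mapping.keys m. F x i ^ Poly_Mapping.lookup m i)"])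
    (intro H F coeff_meas_sum coeff_meas_mult coeff_meas_single coeff_meas_prod coeff_meas_power coeff_measD)+

section \<open>Solvability of linear systems with measurable coefficients\<close>

text \<open>Gaussian elimination: the unknown \<open>p\<close> is removed with any equation \<open>j0\<close> in which it occurs.\<close>
lemma pred_nontrivial_solution:
  fixes a :: "'j :: countable \<Rightarrow> 'i \<Rightarrow> 'x \<Rightarrow> complex"
  assumes "finite I" and "\<And>j i. i \<in> I \<Longrightarrow> a j i \<in> borel_measurable M"
  shows "Measurable.pred M (\<lambda>x. \<exists>c. (\<exists>i\<in>I. c i \<noteq> 0) \<and> (\<forall>j. (\<Sum>i\<in>I. a j i x * c i) = 0))"
  using assms
proof (induction I arbitrary: a rule: finite_induct)
  case empty
  then show ?case by simp
next
  case (insert p I)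
  note [measurable] = insert.prems[OF insertI1] insert.prems[OF insertI2]
  define b where "b j0 j i x = a j i x - a j p x * a j0 i x / a j0 p x" for j0 j i x
  have b [measurable]: "b j0 j i \<in> borel_measurable M" if [simp]: "i \<in> I" for j0 j i
    unfolding b_def[abs_def] by measurable
  have eq: "(\<Sum>i\<in>I. b j0 j i x * c i) = (\<Sum>i\<in>I. a j i x * c i) - a j p x / a j0 p x * (\<Sum>i\<in>I. a j0 i x * c i)"
    for j0 j x c
    by (simp add: b_def algebra_simps sum_subtractf sum_distrib_left)
  \<comment> \<open>If \<open>p\<close> occurs in no equation, the unit vector at \<open>p\<close>
    is a solution. Otherwise equation \<open>j0\<close> determines \<open>c p\<close> from the rest,
    so a nontrivial solution is nontrivial on \<open>I\<close>. The pivot may vary with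
    \<open>x\<close>; the countable disjunction over \<open>j0\<close> allows for that.\<close>
  have iff: "(\<exists>c. (\<exists>i\<in>insert p I. c i \<noteq> 0) \<and> (\<forall>j. (\<Sum>i\<in>insert p I. a j i x * c i) = 0)) \<longleftrightarrow>
      (\<forall>j. a j p x = 0) \<or>
      (\<exists>j0. a j0 p x \<noteq> 0 \<and> (\<exists>c. (\<exists>i\<in>I. c i \<noteq> 0) \<and> (\<forall>j. (\<Sum>i\<in>I. b j0 j i x * c i) = 0)))"
    (is "?L \<longleftrightarrow> ?A \<or> ?B") for x
  proof
    assume ?L
    then obtain c where c: "\<exists>i\<in>insert p I. c i \<noteq> 0"
        and sol: "\<And>j. a j p x * c p + (\<Sum>i\<in>I. a j i x * c i) = 0"
      using insert.hyps by auto
    show "?A \<or> ?B"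
    proof (cases ?A)
      case False
      then obtain j0 where j0: "a j0 p x \<noteq> 0" by blast
      have cp: "(\<Sum>i\<in>I. a j i x * c i) = - (a j p x * c p)" for j
        using sol[of j] by (simp add: eq_neg_iff_add_eq_0 add.commute)
      have "\<exists>i\<in>I. c i \<noteq> 0"
      proof (rule ccontr)
        assume "\<not> ?thesis"
        then have "c p = 0" using sol[of j0] j0 by simp
        with c \<open>\<not> ?thesis\<close> show False by auto
      qed
      moreover have "(\<Sum>i\<in>I. b j0 j i x * c i) = 0" for j
        using j0 by (simp add: eq cp)
      ultimately show ?thesis using j0 by blast
    qed simp
  next
    assume "?A \<or> ?B"
    then show ?L
    proof
      assume ?A
      then show ?L
        using insert.hyps by (intro exI[of _ "\<lambda>i. if i = p then 1 else 0"]) (auto intro!: sum.neutral)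
    next
      assume ?B
      then obtain j0 c where j0: "a j0 p x \<noteq> 0" and c: "\<exists>i\<in>I. c i \<noteq> 0"
          and sol: "\<And>j. (\<Sum>i\<in>I. b j0 j i x * c i) = 0"
        by blast
      define c' where "c' = c(p := - (\<Sum>i\<in>I. a j0 i x * c i) / a j0 p x)"
      have "(\<Sum>i\<in>insert p I. a j i x * c' i) = 0" for j
      proof -
        have "(\<Sum>i\<in>I. a j i x * c' i) = (\<Sum>i\<in>I. a j i x * c i)"
          using insert.hyps by (intro sum.cong) (auto simp: c'_def)
        then show ?thesis
          using insert.hyps sol[of j] by (simp add: eq) (simp add: c'_def)
      qed
      moreover have "\<exists>i\<in>insert p I. c' i \<noteq> 0"
        using c insert.hyps by (auto simp: c'_def)
      ultimately show ?L by blast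
    qed
  qed
  have [measurable]: "Measurable.pred M (\<lambda>x. \<exists>c. (\<exists>i\<in>I. c i \<noteq> 0) \<and> (\<forall>j. (\<Sum>i\<in>I. b j0 j i x * c i) = 0))" for j0
    by (rule insert.IH) (rule b)
  show ?case
    unfolding iff by measurable
qed

lemma finite_mons: "finite (mons N d)"
proof -
  have "Poly_Mapping.lookup m i \<le> d" if "m \<in> mons N d" for m i
  proof (cases "i \<in> Poly_Mapping.keys m")
    case True
    then have "Poly_Mapping.lookup m i \<le> mon_deg m"
      unfolding mon_deg_def by (intro member_le_sum) auto
    then show ?thesis using that by (simp add: mons_def)
  qed (simp add: in_keys_iff)
  then have "Poly_Mapping.lookup ` mons N d \<subseteq> {f. \<forall>i. (i \<in> {..N} \<longrightarrow> f i \<in> {..d}) \<and> (i \<notin> {..N} \<longrightarrow> f i = 0)}"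
    by (auto simp: mons_def in_keys_iff subset_eq)
  then have "finite (Poly_Mapping.lookup ` mons N d)"
    by (rule finite_subset) (intro finite_set_of_finite_funs finite_atMost)
  then show ?thesis
    by (rule finite_imageD) (auto intro: inj_onI poly_mapping_eqI)
qed

lemma lookup_mult_const: "Poly_Mapping.lookup (P * Poly_Mapping.single 0 c) m = Poly_Mapping.lookup P m * (c :: complex)"
  for P :: mpoly
proof -
  have "Poly_Mapping.lookup (Poly_Mapping.map ((*) c) P) m = c * Poly_Mapping.lookup P m"
    by (simp add: Poly_Mapping.map.rep_eq when_def)
  then show ?thesis
    by (simp add: mult_map_scale_conv_mult mult.commute)
qed

text \<open>The unknowns are the coefficients \<open>c (k, \<mu>)\<close> of the components of
  \<open>G\<close>. Comparing coefficients at each monomial turns \<open>same_map\<close> into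
  homogeneous linear equations, and \<open>rep\<close> says that the solution is nontrivial.\<close>

lemma pred_rep_same_map:
  assumes F: "\<And>i. coeff_meas M (\<lambda>x. F x i)"
  shows "Measurable.pred M (\<lambda>x. \<exists>G. rep N G d \<and> same_map N (F x) G)"
proof -
  define I where "I = {..N} \<times> mons N d"
  define lk where "lk x i \<mu> m = Poly_Mapping.lookup (F x i * Poly_Mapping.single \<mu> 1) m" for x i \<mu> m
  \<comment> \<open>Equation \<open>(i, j, m)\<close> compares the coefficients of
    \<open>F x i * G j\<close> and \<open>F x j * G i\<close> at \<open>m\<close>. Triples with
    \<open>i\<close> or \<open>j\<close> above \<open>N\<close> give trivial equations, so that the
    equations are indexed by a whole countable type.\<close>
  define a where "a = (\<lambda>(i, j, m) (k, \<mu>) x. if i \<le> N \<and> j \<le> N then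
      (if k = j then lk x i \<mu> m else 0) - (if k = i then lk x j \<mu> m else 0) else 0)"
  define P where "P c k = (\<Sum>\<mu>\<in>mons N d. Poly_Mapping.single \<mu> (c (k, \<mu>)))" for c :: "nat \<times> (nat \<Rightarrow>\<^sub>0 nat) \<Rightarrow> complex" and k :: nat
  have lookup_P: "Poly_Mapping.lookup (P c k) \<mu> = (if \<mu> \<in> mons N d then c (k, \<mu>) else 0)" for c k \<mu>
    by (simp add: P_def lookup_sum lookup_single when_def finite_mons)
  have lookup_FP: "Poly_Mapping.lookup (F x i * P c k) m = (\<Sum>\<mu>\<in>mons N d. lk x i \<mu> m * c (k, \<mu>))" for x i c k m
  proof -
    have "F x i * P c k = (\<Sum>\<mu>\<in>mons N d. F x i * Poly_Mapping.single \<mu> 1 * Poly_Mapping.single 0 (c (k, \<mu>)))"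
      by (simp add: P_def sum_distrib_left mult_single mult.assoc)
    then show ?thesis
      by (simp add: lookup_sum lookup_mult_const lk_def)
  qed
  have eqn: "(\<Sum>p\<in>I. a (i, j, m) p x * c p)
      = Poly_Mapping.lookup (F x i * P c j) m - Poly_Mapping.lookup (F x j * P c i) m"
    if ij: "i \<le> N" "j \<le> N" for i j m x c
  proof -
    have "(\<Sum>p\<in>I. a (i, j, m) p x * c p) = (\<Sum>k\<le>N. \<Sum>\<mu>\<in>mons N d. a (i, j, m) (k, \<mu>) x * c (k, \<mu>))"
      by (simp add: I_def sum.cartesian_product)
    also have "\<dots> = (\<Sum>k\<le>N. (if k = j then \<Sum>\<mu>\<in>mons N d. lk x i \<mu> m * c (k, \<mu>) else 0)
        - (if k = i then \<Sum>\<mu>\<in>mons N d. lk x j \<mu> m * c (k, \<mu>) else 0))"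
      using ij by (intro sum.cong refl) (auto simp: a_def left_diff_distrib sum_subtractf sum_negf)
    also have "\<dots> = (\<Sum>\<mu>\<in>mons N d. lk x i \<mu> m * c (j, \<mu>)) - (\<Sum>\<mu>\<in>mons N d. lk x j \<mu> m * c (i, \<mu>))"
      using ij by (simp add: sum_subtractf)
    finally show ?thesis by (simp add: lookup_FP)
  qed
  have same_P: "same_map N (F x) (P c) \<longleftrightarrow> (\<forall>e. (\<Sum>p\<in>I. a e p x * c p) = 0)" for x c
  proof -
    have "(\<Sum>p\<in>I. a (i, j, m) p x * c p) = 0" if "\<not> (i \<le> N \<and> j \<le> N)" for i j m
      using that by (intro sum.neutral) (auto simp: a_def)
    then have "(\<forall>e. (\<Sum>p\<in>I. a e p x * c p) = 0) \<longleftrightarrow> (\<forall>i\<le>N. \<forall>j\<le>N. \<forall>m. (\<Sum>p\<in>I. a (i, j, m) p x * c p) = 0)"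
      by (metis prod_cases3)
    also have "\<dots> \<longleftrightarrow> same_map N (F x) (P c)"
      by (auto simp: same_map_def eqn poly_mapping_eq_iff fun_eq_iff)
    finally show ?thesis by simp
  qed
  have rep_P: "rep N (P c) d \<longleftrightarrow> (\<exists>p\<in>I. c p \<noteq> 0)" for c
  proof -
    have "homog N d (P c k)" for k
      by (auto simp: homog_iff in_keys_iff lookup_P split: if_splits)
    moreover have "P c k \<noteq> 0 \<longleftrightarrow> (\<exists>\<mu>\<in>mons N d. c (k, \<mu>) \<noteq> 0)" for k
      by (auto simp: poly_mapping_eq_iff fun_eq_iff lookup_P)
    ultimately show ?thesis by (auto simp: rep_def I_def)
  qed
  have "(\<exists>G. rep N G d \<and> same_map N (F x) G) \<longleftrightarrow> (\<exists>c. (\<exists>p\<in>I. c p \<noteq> 0) \<and> (\<forall>e. (\<Sum>p\<in>I. a e p x * c p) = 0))" for x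
  proof
    assume "\<exists>G. rep N G d \<and> same_map N (F x) G"
    then obtain G where G: "rep N G d" "same_map N (F x) G" by blast
    define c where "c = (\<lambda>(k, \<mu>). Poly_Mapping.lookup (G k) \<mu>)"
    have "P c k = G k" if "k \<le> N" for k
      using rep_homog[OF G(1) that] by (intro poly_mapping_eqI) (auto simp: lookup_P c_def homog_iff in_keys_iff)
    then have "rep N (P c) d" "same_map N (F x) (P c)"
      using G by (auto simp: rep_def same_map_def)
    then show "\<exists>c. (\<exists>p\<in>I. c p \<noteq> 0) \<and> (\<forall>e. (\<Sum>p\<in>I. a e p x * c p) = 0)"
      unfolding rep_P same_P by blast
  next
    assume "\<exists>c. (\<exists>p\<in>I. c p \<noteq> 0) \<and> (\<forall>e. (\<Sum>p\<in>I. a e p x * c p) = 0)"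
    then show "\<exists>G. rep N G d \<and> same_map N (F x) G"
      unfolding rep_P[symmetric] same_P[symmetric] by blast
  qed
  moreover have "Measurable.pred M (\<lambda>x. \<exists>c. (\<exists>p\<in>I. c p \<noteq> 0) \<and> (\<forall>e. (\<Sum>p\<in>I. a e p x * c p) = 0))"
  proof (rule pred_nontrivial_solution)
    show "finite I" by (simp add: I_def finite_mons)
    have lk [measurable]: "(\<lambda>x. lk x i \<mu> m) \<in> borel_measurable M" for i \<mu> m
      unfolding lk_def by (intro coeff_measD coeff_meas_mult F coeff_meas_const)
    show "a e p \<in> borel_measurable M" for e p
      by (cases e; cases p) (simp add: a_def)
  qed
  ultimately show ?thesis by simp
qed

lemma measurable_rdeg:
  assumes "\<And>i. coeff_meas M (\<lambda>x. F x i)"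
  shows "(\<lambda>x. rdeg N (F x)) \<in> measurable M (count_space UNIV)"
  unfolding rdeg_def by (intro measurable_Least pred_rep_same_map assms)

text \<open>The index set is general because the process lives on all of \<open>UNIV\<close> and
  \<open>En_logdeg\<close> on \<open>{..<n}\<close>. On a single factor every set is measurable, and
  composition preserves measurable coefficients.\<close>

lemma coeff_meas_gamma:
  assumes "{..<n} \<subseteq> J" and "\<And>i. i \<in> J \<Longrightarrow> sets (\<mu> i) = UNIV"
  shows "coeff_meas (PiM J \<mu>) (\<lambda>th. gamma th n i)"
  using assms(1)
proof (induction n arbitrary: i)
  case 0
  then show ?case by (simp add: coeff_meas_const)
next
  case (Suc n)
  then have n: "n \<in> J" by auto
  have "coeff_meas (PiM J \<mu>) (\<lambda>th. th n i)"
    unfolding coeff_meas_def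
  proof
    fix m
    have "(\<lambda>F. Poly_Mapping.lookup (F i) m) \<in> borel_measurable (\<mu> n)"
      using assms(2)[OF n] sets_eq_imp_space_eq[of "\<mu> n" "count_space UNIV"] by (auto simp: measurable_def)
    then show "(\<lambda>th. Poly_Mapping.lookup (th n i) m) \<in> borel_measurable (PiM J \<mu>)"
      by (rule measurable_compose[OF measurable_component_singleton[OF n]])
  qed
  moreover have "{..<n} \<subseteq> J" using Suc.prems by auto
  ultimately show ?case
    using Suc.IH by (auto simp: rcomp_def intro!: coeff_meas_subst)
qed

lemma measurable_rdeg_gamma:
  assumes "{..<n} \<subseteq> J"
  shows "(\<lambda>th. rdeg N (gamma th n)) \<in> measurable (PiM J (\<lambda>_. measure_pmf \<nu>)) (count_space UNIV)"
  using assms by (intro measurable_rdeg coeff_meas_gamma) auto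

section \<open>Dynamical degrees of random sequences\<close>

theorem theorem1p1:
  fixes N :: nat and S :: "rmap set" and \<nu> :: "rmap pmf"
  assumes "N \<ge> 1"
    and "countable S"
    and "\<forall>F\<in>S. dom_rat_map N F"
    and "set_pmf \<nu> \<subseteq> S"
    and "integrable (measure_pmf \<nu>) (\<lambda>F. ln (real (rdeg N F)))"
  shows "AE th in PiM UNIV (\<lambda>_::nat. measure_pmf \<nu>).
           (\<lambda>n. real (rdeg N (gamma th n)) powr (1 / real n)) \<longlonglongrightarrow> delta N \<nu>"
proof -
  let ?M = "PiM UNIV (\<lambda>_::nat. measure_pmf \<nu>)"
  let ?T = "\<lambda>th n. th (Suc n) :: rmap"
  interpret product_prob_space "\<lambda>_::nat. measure_pmf \<nu>" UNIV ..
  interpret ergodic_map ?M ?T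
    by (rule ergodic_shift) unfold_locales
  define supp where "supp th \<longleftrightarrow> (\<forall>i::nat. th i \<in> set_pmf \<nu>)" for th
  define f where "f n th = ln (real (rdeg N (gamma th n)))" for n th
  \<comment> \<open>The value 0 off the support makes subadditivity hold at every point, as the
    locale demands, and changes \<open>f\<close> only on a null set.\<close>
  define g where "g n th = (if supp th then f n th else 0)" for n th
  have f_meas [measurable]: "f n \<in> borel_measurable (PiM J (\<lambda>_. measure_pmf \<nu>))" if "{..<n} \<subseteq> J" for n J
    unfolding f_def by (intro measurable_compose[OF measurable_rdeg_gamma[OF that]]) simp
  have AE_supp: "AE th in ?M. supp th"
    unfolding supp_def AE_all_countable by (intro allI AE_component) (auto simp: AE_measure_pmf)
  have supp_meas [measurable]: "Measurable.pred ?M supp"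
  proof -
    have "(\<lambda>F. F \<in> set_pmf \<nu>) \<in> measurable (measure_pmf \<nu>) (count_space UNIV)" by simp
    then have "Measurable.pred ?M (\<lambda>th. th i \<in> set_pmf \<nu>)" for i
      by (rule measurable_compose[OF measurable_component_singleton[OF UNIV_I]])
    then show ?thesis unfolding supp_def by measurable
  qed
  have g_meas [measurable]: "g n \<in> borel_measurable ?M" for n
    unfolding g_def by (intro measurable_If f_meas supp_meas) auto
  have dom: "dom_rep N (th i)" if "supp th" for th i
    using that assms(3,4) by (auto simp: supp_def dom_rat_map_def dom_rep_def)
  have deg: "rdeg N (gamma th n) \<ge> 1" if "supp th" for th n
    using that dom by (intro rdeg_ge_1 assms(1) dom_rep_gamma)
  have g_nonneg: "0 \<le> g n th" for n th
    using deg[of th n] by (simp add: g_def f_def)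
  have g_add: "g (m + n) th \<le> g m th + g n ((?T ^^ m) th)" for m n th
  proof (cases "supp th")
    case True
    have shift: "(?T ^^ m) th = (\<lambda>i. th (m + i))" by (simp add: shift_iter add.commute)
    have supp': "supp ((?T ^^ m) th)" using True by (simp add: supp_def shift)
    have "real (rdeg N (gamma th (m + n))) \<le> real (rdeg N (gamma ((?T ^^ m) th) n)) * real (rdeg N (gamma th m))"
      unfolding shift of_nat_mult[symmetric] of_nat_le_iff
      using dom[OF True] by (rule rdeg_gamma_add_le)
    then have "ln (real (rdeg N (gamma th (m + n))))
        \<le> ln (real (rdeg N (gamma ((?T ^^ m) th) n)) * real (rdeg N (gamma th m)))"
      using deg[OF True, of "m + n"] by (intro ln_mono) auto
    then show ?thesis
      using deg[OF True, of m] deg[OF supp', of n] True supp' by (simp add: g_def f_def ln_mult)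
  qed (use g_nonneg in \<open>auto simp: g_def\<close>)
  have g_zero: "g 0 th = 0" for th
    using rdeg_var[OF assms(1)] by (simp add: g_def f_def)
  have f_1: "f 1 th = ln (real (rdeg N (th 0)))" for th
    by (simp add: f_def rcomp_def subst_id)
  have "integrable ?M (\<lambda>th. ln (real (rdeg N (th 0))))"
    using integrable_distr[of "\<lambda>\<omega>. \<omega> 0" ?M "measure_pmf \<nu>"] assms(5) by (simp add: PiM_component)
  then have int_1: "integrable ?M (g 1)"
    by (rule Bochner_Integration.integrable_bound) (auto simp: g_def f_1 simp del: One_nat_def)
  \<comment> \<open>Subadditivity and nonnegativity put \<open>g (Suc n)\<close> between 0 and the
    integrable function \<open>g n + g 1\<close> with the latter taken along the \<open>n\<close>-th
    shift.\<close>
  have int_g: "integrable ?M (g n)" for n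
  proof (induction n)
    case 0
    then show ?case by (simp add: g_zero[abs_def])
  next
    case (Suc n)
    have "integrable ?M (\<lambda>th. g n th + g 1 ((?T ^^ n) th))"
      using Suc int_1 by (intro Bochner_Integration.integrable_add integrable_iter)
    then show ?case
    proof (rule Bochner_Integration.integrable_bound)
      have "norm (g (Suc n) th) \<le> norm (g n th + g 1 ((?T ^^ n) th))" for th
        using g_add[of n 1 th] g_nonneg[of "Suc n" th] by (simp only: real_norm_def Suc_eq_plus1)
      then show "AE th in ?M. norm (g (Suc n) th) \<le> norm (g n th + g 1 ((?T ^^ n) th))"
        by simp
    qed simp
  qed
  interpret subadditive_process ?M ?T g
    by standard (use int_g g_zero g_add in auto)
  \<comment> \<open>\<open>gamma th n\<close> depends on the first \<open>n\<close> maps only, so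
    the integral descends to the finite product, where \<open>En_logdeg\<close> is defined.\<close>
  have mean: "(\<integral>th. g n th \<partial>?M) = En_logdeg N \<nu> n" for n
  proof -
    have "(\<integral>th. g n th \<partial>?M) = (\<integral>th. f n th \<partial>?M)"
      using AE_supp by (intro integral_cong_AE) (auto simp: g_def)
    also have "\<dots> = (\<integral>th. f n (restrict th {..<n}) \<partial>?M)"
      unfolding f_def by (intro Bochner_Integration.integral_cong arg_cong[of _ _ "\<lambda>F. ln (real (rdeg N F))"] gamma_cong) auto
    also have "\<dots> = (\<integral>th. f n th \<partial>distr ?M (PiM {..<n} (\<lambda>_. measure_pmf \<nu>)) (\<lambda>th. restrict th {..<n}))"
      by (intro integral_distr[symmetric] f_meas measurable_restrict_subset) auto
    also have "\<dots> = En_logdeg N \<nu> n"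
      by (subst distr_PiM_restrict_finite) (auto simp: En_logdeg_def f_def[abs_def])
    finally show ?thesis .
  qed
  have "bdd_below ((\<lambda>n. (\<integral>th. g n th \<partial>?M) / real n) ` {1..})"
    by (intro bdd_belowI2[of _ 0] divide_nonneg_nonneg integral_nonneg) (auto simp: g_nonneg)
  from kingman[OF this] AE_supp show ?thesis
  proof eventually_elim
    case (elim th)
    have "(\<lambda>n. exp (g n th / real n)) \<longlonglongrightarrow> delta N \<nu>"
      unfolding delta_def using elim(1) by (intro tendsto_exp) (simp add: mean)
    moreover have "\<forall>\<^sub>F n in sequentially. exp (g n th / real n) = real (rdeg N (gamma th n)) powr (1 / real n)"
    proof (intro eventually_sequentiallyI[of 1])
      fix n :: nat
      show "exp (g n th / real n) = real (rdeg N (gamma th n)) powr (1 / real n)"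
        using elim(2) deg[OF elim(2), of n] by (simp add: powr_def g_def f_def)
    qed
    ultimately show ?case
      by (rule Lim_transform_eventually)
  qed
qed

end
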